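(* Let $A$ be a set-theoretically weakly $1$-pseudoconcave locally closed subset of a reduced complex space $X$ on which a global strictly plurisubharmonic function $\rho$ is defined. Then for every relatively compact open subset $D$ of $A$ one has $$\max_{z\in\overline D}|f(z)|=\max_{z\in\partial_A D}|f(z)|\qquad\text{for all } f\in\tilde{\mathscr{O}}_A(D)\cap\mathcal{C}^0(\overline D).$$
   Context: Complex spaces are Hausdorff, and $X$ is a reduced complex space of pure dimension. A strictly plurisubharmonic function on $X$ is a real valued function which, locally in embeddings of open pieces of $X$ as analytic subvarieties of open sets of $\mathbb{C}^N$, is the restriction of a $\mathcal{C}^2$ strictly plurisubharmonic function (it is not required to be an exhaustion). $\partial_A D$ is the boundary of $D$ in $A$ and $\overline D$ its closure in $A$. The maximum of nonnegative numbers over the empty set is $0$. Pseudoconcavity. Let $q$ be an integer, $p\in A$. $A$ is set-theoretically $q$-pseudoconvex at $p$ if there are an open neighbourhood $\omega_p$ of $p$ in $X$, an isomorphism $z$ of $\omega_p$ onto a local model $Z$ (a closed analytic subvariety of an open set $U\subset\mathbb{C}^N$, with its reduced structure), a function $\rho\in\mathcal{C}^\infty(U,\mathbb{R})$ and an open set $\omega'_p$ with $p\in\omega'_p\subseteq\omega_p$ such that $z(A\cap\omega'_p)\subseteq\{\rho\le\rho(z(p))\}$ and the complex Hessian $(\partial^2\rho/\partial z_i\partial\bar z_j)$ at $z(p)$ has at least $N-q+1$ positive eigenvalues. (This does not depend on the choice of the local model.) $A$ is set-theoretically weakly $q$-pseudoconcave if it is not set-theoretically $q$-pseudoconvex at any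 $p\in A$. LACR functions. $\mathcal{C}_A$ is the sheaf of germs of continuous complex valued functions on $A$. $\mathscr{O}_A\subseteq\mathcal{C}_A$ is the subsheaf of germs of functions that are, near each point, restrictions to $A$ of holomorphic functions on open subsets of $X$. For a set $\mathcal{H}$ of germs of continuous functions on $A$ and $U$ open in $A$, $\mathcal{H}(U)$ is the set of continuous functions on $U$ all of whose germs belong to $\mathcal{H}$; $\mathcal{H}^c$ is the set of germs $f_{(x)}$ having, on some open neighbourhood $U_x$ of $x$ in $A$, a representative which is the limit, uniformly on compact subsets of $U_x$, of a sequence in $\mathcal{H}(U_x)$. $\mathcal{H}^{(c)}$ is the smallest set of germs that contains $\mathcal{H}$ and is stable under $\mathcal{H}\mapsto\mathcal{H}^c$. The sheaf of LACR functions is $\tilde{\mathscr{O}}_A=\mathscr{O}_A^{(c)}$. *)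

theory Defs
  imports "HOL-Analysis.Analysis" "Jordan_Normal_Form.Char_Poly"
begin

section \<open>Calculus on open subsets of complex N-space\<close>

text \<open>
  The embedding dimension of a complex space varies from point to point, so the number N has to be
  a term. Complex N-space is the set of sequences vanishing from index N on; the subspace topology
  it gets from the product topology on functions is the Euclidean one.
\<close>

definition cspace :: "nat \<Rightarrow> (nat \<Rightarrow> complex) set" where
  "cspace N = {z. \<forall>i\<ge>N. z i = 0}"

definition open_in_cspace :: "nat \<Rightarrow> (nat \<Rightarrow> complex) set \<Rightarrow> bool" where
  "open_in_cspace N U \<longleftrightarrow> openin (top_of_set (cspace N)) U"

definition holomorphic_in :: "nat \<Rightarrow> (nat \<Rightarrow> complex) set \<Rightarrow> ((nat \<Rightarrow> complex) \<Rightarrow> complex) \<Rightarrow> bool" where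
  "holomorphic_in N U F \<longleftrightarrow>
     continuous_on U F \<and>
     (\<forall>z\<in>U. \<forall>j<N. (\<lambda>w. F (z(j := w))) field_differentiable at (z j))"

text \<open>
  Real partial derivative in the j-th complex coordinate, in the direction \<open>d\<close>:
  \<open>d = 1\<close> gives the derivative in the real part, \<open>d = \<i>\<close> the one in the imaginary part.
\<close>

definition curve :: "(nat \<Rightarrow> complex) \<Rightarrow> nat \<Rightarrow> complex \<Rightarrow> real \<Rightarrow> (nat \<Rightarrow> complex)" where
  "curve z j d t = z(j := z j + of_real t * d)"

definition partial_deriv ::
    "nat \<Rightarrow> complex \<Rightarrow> ((nat \<Rightarrow> complex) \<Rightarrow> 'b::real_normed_vector) \<Rightarrow> (nat \<Rightarrow> complex) \<Rightarrow> 'b" where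
  "partial_deriv j d F z = vector_derivative (\<lambda>t. F (curve z j d t)) (at 0)"

primrec C_k :: "nat \<Rightarrow> nat \<Rightarrow> (nat \<Rightarrow> complex) set \<Rightarrow> ((nat \<Rightarrow> complex) \<Rightarrow> real) \<Rightarrow> bool" where
  "C_k 0 N U F \<longleftrightarrow> continuous_on U F"
| "C_k (Suc k) N U F \<longleftrightarrow>
     continuous_on U F \<and>
     (\<forall>j<N. \<forall>d\<in>{1, \<i>}.
        (\<forall>z\<in>U. (\<lambda>t. F (curve z j d t)) differentiable at 0) \<and>
        C_k k N U (partial_deriv j d F))"

definition C_infinity :: "nat \<Rightarrow> (nat \<Rightarrow> complex) set \<Rightarrow> ((nat \<Rightarrow> complex) \<Rightarrow> real) \<Rightarrow> bool" where
  "C_infinity N U F \<longleftrightarrow> (\<forall>k. C_k k N U F)"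

definition wirtinger :: "nat \<Rightarrow> ((nat \<Rightarrow> complex) \<Rightarrow> complex) \<Rightarrow> (nat \<Rightarrow> complex) \<Rightarrow> complex" where
  "wirtinger j F z = (partial_deriv j 1 F z - \<i> * partial_deriv j \<i> F z) / 2"

definition wirtinger_bar :: "nat \<Rightarrow> ((nat \<Rightarrow> complex) \<Rightarrow> complex) \<Rightarrow> (nat \<Rightarrow> complex) \<Rightarrow> complex" where
  "wirtinger_bar j F z = (partial_deriv j 1 F z + \<i> * partial_deriv j \<i> F z) / 2"

definition complex_hessian ::
    "nat \<Rightarrow> ((nat \<Rightarrow> complex) \<Rightarrow> real) \<Rightarrow> (nat \<Rightarrow> complex) \<Rightarrow> complex mat" where
  "complex_hessian N F z =
     Matrix.mat N N (\<lambda>(i, j). wirtinger i (wirtinger_bar j (\<lambda>w. of_real (F w))) z)"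

text \<open>Eigenvalues are counted with multiplicity. For Hermitian matrices, algebraic and geometric
  multiplicities agree.\<close>

definition num_pos_eigenvalues :: "complex mat \<Rightarrow> nat" where
  "num_pos_eigenvalues H =
     (\<Sum>e \<in> {e::real. 0 < e \<and> eigenvalue H (of_real e)}. Polynomial.order (of_real e) (char_poly H))"

definition C2_strictly_psh :: "nat \<Rightarrow> (nat \<Rightarrow> complex) set \<Rightarrow> ((nat \<Rightarrow> complex) \<Rightarrow> real) \<Rightarrow> bool" where
  "C2_strictly_psh N U F \<longleftrightarrow>
     C_k 2 N U F \<and>
     (\<forall>z\<in>U. \<forall>v\<in>cspace N. v \<noteq> (\<lambda>_. 0) \<longrightarrow>
        0 < Re (\<Sum>i<N. \<Sum>j<N. complex_hessian N F z $$ (i, j) * v i * cnj (v j)))"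


section \<open>Reduced complex spaces\<close>

definition analytic_subvariety :: "nat \<Rightarrow> (nat \<Rightarrow> complex) set \<Rightarrow> (nat \<Rightarrow> complex) set \<Rightarrow> bool" where
  "analytic_subvariety N U Z \<longleftrightarrow>
     Z \<subseteq> U \<and>
     (\<forall>w\<in>U. \<exists>W \<F>. open_in_cspace N W \<and> w \<in> W \<and> W \<subseteq> U \<and>
        finite \<F> \<and> (\<forall>F\<in>\<F>. holomorphic_in N W F) \<and>
        Z \<inter> W = {x \<in> W. \<forall>F\<in>\<F>. F x = 0})"

text \<open>
  A reduced complex space is a topological space \<open>X\<close> with a sheaf \<open>\<O>\<close> of complex valued functions:
  \<open>\<O> V\<close> is the set of holomorphic functions on the open set \<open>V\<close>. Its members are total functions
  of which only the values on \<open>V\<close> are relevant.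

  The predicate below says that \<open>z\<close> is an isomorphism of the open subspace \<open>\<omega>\<close> onto the closed
  analytic subvariety \<open>Z\<close> of the open set \<open>U\<close> of complex N-space, with its reduced structure: the
  functions holomorphic on \<open>V \<subseteq> \<omega>\<close> are those which, transported by \<open>z\<close>, are locally restrictions of
  holomorphic functions of N variables.
\<close>

definition local_model_iso ::
    "'a topology \<Rightarrow> ('a set \<Rightarrow> ('a \<Rightarrow> complex) set) \<Rightarrow> 'a set \<Rightarrow> ('a \<Rightarrow> nat \<Rightarrow> complex) \<Rightarrow>
     nat \<Rightarrow> (nat \<Rightarrow> complex) set \<Rightarrow> (nat \<Rightarrow> complex) set \<Rightarrow> bool" where
  "local_model_iso X \<O> \<omega> z N U Z \<longleftrightarrow>
     openin X \<omega> \<and> open_in_cspace N U \<and> analytic_subvariety N U Z \<and>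
     homeomorphic_map (subtopology X \<omega>) (top_of_set Z) z \<and>
     (\<forall>V f. openin X V \<and> V \<subseteq> \<omega> \<longrightarrow>
        (f \<in> \<O> V \<longleftrightarrow>
          (\<forall>x\<in>V. \<exists>W F. open_in_cspace N W \<and> z x \<in> W \<and> holomorphic_in N W F \<and>
             (\<forall>y\<in>V. z y \<in> W \<longrightarrow> f y = F (z y)))))"

locale reduced_complex_space =
  fixes X :: "'a topology" and \<O> :: "'a set \<Rightarrow> ('a \<Rightarrow> complex) set"
  assumes Hausdorff: "Hausdorff_space X"
    and sheaf_cong:
      "\<And>V f g. openin X V \<Longrightarrow> f \<in> \<O> V \<Longrightarrow> (\<And>x. x \<in> V \<Longrightarrow> g x = f x) \<Longrightarrow> g \<in> \<O> V"
    and sheaf_restrict: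
      "\<And>V W f. openin X V \<Longrightarrow> openin X W \<Longrightarrow> W \<subseteq> V \<Longrightarrow> f \<in> \<O> V \<Longrightarrow> f \<in> \<O> W"
    and sheaf_glue:
      "\<And>V f. openin X V \<Longrightarrow> (\<And>x. x \<in> V \<Longrightarrow> \<exists>W. openin X W \<and> x \<in> W \<and> W \<subseteq> V \<and> f \<in> \<O> W) \<Longrightarrow> f \<in> \<O> V"
    and local_model:
      "\<And>p. p \<in> topspace X \<Longrightarrow> \<exists>\<omega> z N U Z. p \<in> \<omega> \<and> local_model_iso X \<O> \<omega> z N U Z"

definition regular_point ::
    "'a topology \<Rightarrow> ('a set \<Rightarrow> ('a \<Rightarrow> complex) set) \<Rightarrow> nat \<Rightarrow> 'a \<Rightarrow> bool" where
  "regular_point X \<O> n x \<longleftrightarrow> (\<exists>\<omega> z U. x \<in> \<omega> \<and> local_model_iso X \<O> \<omega> z n U U)"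

text \<open>The dimension at \<open>p\<close> is the upper limit, at \<open>p\<close>, of the dimensions of the complex manifold
  of regular points.\<close>

definition has_dimension_at ::
    "'a topology \<Rightarrow> ('a set \<Rightarrow> ('a \<Rightarrow> complex) set) \<Rightarrow> 'a \<Rightarrow> nat \<Rightarrow> bool" where
  "has_dimension_at X \<O> p n \<longleftrightarrow>
     (\<forall>V. openin X V \<and> p \<in> V \<longrightarrow> (\<exists>x\<in>V. regular_point X \<O> n x)) \<and>
     (\<exists>V. openin X V \<and> p \<in> V \<and> (\<forall>x\<in>V. \<forall>m. regular_point X \<O> m x \<longrightarrow> m \<le> n))"

definition pure_dimensional :: "'a topology \<Rightarrow> ('a set \<Rightarrow> ('a \<Rightarrow> complex) set) \<Rightarrow> bool" where
  "pure_dimensional X \<O> \<longleftrightarrow> (\<exists>n. \<forall>p\<in>topspace X. has_dimension_at X \<O> p n)"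

definition strictly_psh_on_space ::
    "'a topology \<Rightarrow> ('a set \<Rightarrow> ('a \<Rightarrow> complex) set) \<Rightarrow> ('a \<Rightarrow> real) \<Rightarrow> bool" where
  "strictly_psh_on_space X \<O> \<rho> \<longleftrightarrow>
     (\<forall>p\<in>topspace X. \<exists>\<omega> z N U Z \<rho>'.
        p \<in> \<omega> \<and> local_model_iso X \<O> \<omega> z N U Z \<and> C2_strictly_psh N U \<rho>' \<and>
        (\<forall>x\<in>\<omega>. \<rho> x = \<rho>' (z x)))"


section \<open>Set-theoretic pseudoconcavity\<close>

definition locally_closed_in :: "'a topology \<Rightarrow> 'a set \<Rightarrow> bool" where
  "locally_closed_in X A \<longleftrightarrow> (\<exists>V F. openin X V \<and> closedin X F \<and> A = V \<inter> F)"

definition pseudoconvex_at ::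
    "'a topology \<Rightarrow> ('a set \<Rightarrow> ('a \<Rightarrow> complex) set) \<Rightarrow> int \<Rightarrow> 'a set \<Rightarrow> 'a \<Rightarrow> bool" where
  "pseudoconvex_at X \<O> q A p \<longleftrightarrow>
     (\<exists>\<omega> z N U Z \<rho> \<omega>'.
        p \<in> \<omega> \<and> local_model_iso X \<O> \<omega> z N U Z \<and> C_infinity N U \<rho> \<and>
        openin X \<omega>' \<and> p \<in> \<omega>' \<and> \<omega>' \<subseteq> \<omega> \<and>
        z ` (A \<inter> \<omega>') \<subseteq> {w \<in> U. \<rho> w \<le> \<rho> (z p)} \<and>
        int (num_pos_eigenvalues (complex_hessian N \<rho> (z p))) \<ge> int N - q + 1)"

definition weakly_pseudoconcave ::
    "'a topology \<Rightarrow> ('a set \<Rightarrow> ('a \<Rightarrow> complex) set) \<Rightarrow> int \<Rightarrow> 'a set \<Rightarrow> bool" where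
  "weakly_pseudoconcave X \<O> q A \<longleftrightarrow> (\<forall>p\<in>A. \<not> pseudoconvex_at X \<O> q A p)"


section \<open>LACR functions\<close>

text \<open>
  The germ at \<open>x\<close>, along \<open>A\<close>, of a function: the base point together with the class of all functions
  equal to it on some neighbourhood of \<open>x\<close> in \<open>A\<close>. A function defined near \<open>x\<close> only is represented
  by any extension.
\<close>

type_synonym 'a germ = "'a \<times> ('a \<Rightarrow> complex) set"

definition germ_at :: "'a topology \<Rightarrow> 'a set \<Rightarrow> 'a \<Rightarrow> ('a \<Rightarrow> complex) \<Rightarrow> 'a germ" where
  "germ_at X A x f =
     (x, {g. \<exists>V. openin (subtopology X A) V \<and> x \<in> V \<and> (\<forall>y\<in>V. g y = f y)})"

definition continuous_fun :: "'a topology \<Rightarrow> 'a set \<Rightarrow> ('a \<Rightarrow> complex) \<Rightarrow> bool" where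
  "continuous_fun X S f \<longleftrightarrow> continuous_map (subtopology X S) euclidean f"

text \<open>For \<open>U\<close> open in \<open>A\<close>, the functions on \<open>U\<close> all of whose germs belong to \<open>\<H>\<close>.\<close>

definition sections ::
    "'a topology \<Rightarrow> 'a set \<Rightarrow> 'a germ set \<Rightarrow> 'a set \<Rightarrow> ('a \<Rightarrow> complex) set" where
  "sections X A \<H> U = {f. continuous_fun X U f \<and> (\<forall>x\<in>U. germ_at X A x f \<in> \<H>)}"

definition c_step :: "'a topology \<Rightarrow> 'a set \<Rightarrow> 'a germ set \<Rightarrow> 'a germ set" where
  "c_step X A \<H> =
     {germ_at X A x f | x f. \<exists>U g.
        openin (subtopology X A) U \<and> x \<in> U \<and> continuous_fun X U f \<and>
        (\<forall>n::nat. g n \<in> sections X A \<H> U) \<and>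
        (\<forall>K. compactin X K \<and> K \<subseteq> U \<longrightarrow> uniform_limit K g f sequentially)}"

definition c_closure :: "'a topology \<Rightarrow> 'a set \<Rightarrow> 'a germ set \<Rightarrow> 'a germ set" where
  "c_closure X A \<H> = \<Inter>{\<G>. \<H> \<subseteq> \<G> \<and> c_step X A \<G> \<subseteq> \<G>}"

definition holomorphic_germs ::
    "'a topology \<Rightarrow> ('a set \<Rightarrow> ('a \<Rightarrow> complex) set) \<Rightarrow> 'a set \<Rightarrow> 'a germ set" where
  "holomorphic_germs X \<O> A =
     {germ_at X A x F | x F. x \<in> A \<and> (\<exists>W. openin X W \<and> x \<in> W \<and> F \<in> \<O> W)}"

definition LACR ::
    "'a topology \<Rightarrow> ('a set \<Rightarrow> ('a \<Rightarrow> complex) set) \<Rightarrow> 'a set \<Rightarrow> 'a set \<Rightarrow> ('a \<Rightarrow> complex) set" where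
  "LACR X \<O> A U = sections X A (c_closure X A (holomorphic_germs X \<O> A)) U"


text \<open>The maximum of a set of nonnegative numbers that has one, and 0 for the empty set.\<close>

definition max_or_zero :: "real set \<Rightarrow> real" where
  "max_or_zero S = (if S = {} then 0 else (GREATEST y. y \<in> S))"

end

theory Submission
  imports Defs "HOL-Complex_Analysis.Cauchy_Integral_Formula"
begin

text \<open>
  Say that \<open>f\<close> peaks at \<open>p\<close> if, in some local model near \<open>p\<close>, there is a holomorphic \<open>G\<close> such that
  \<open>|f G|\<close> restricted to \<open>A\<close> is at most \<open>|f G|(p) exp (-\<epsilon> |z - z(p)|\<^sup>2)\<close>, with a nonzero value at \<open>p\<close>.
  If \<open>f\<close> is holomorphic and peaks at \<open>p\<close>, then, normalising \<open>f G\<close> to be 1 at \<open>p\<close>, the function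
  \<open>Re (f G) + (\<epsilon>/2) |z - z(p)|\<^sup>2\<close> shows that \<open>A\<close> is 1-pseudoconvex at \<open>p\<close>; so holomorphic functions
  have no peaks. The absence of peaks is local and survives locally uniform limits, hence it holds
  for all LACR functions.
  If \<open>|f|\<close> were larger somewhere on the closure of \<open>D\<close> than on its boundary, then for small \<open>\<tau> > 0\<close>
  the function \<open>|f| exp (\<tau> \<rho>)\<close> would have its maximum at a point of \<open>D\<close>. Near that point \<open>\<rho>\<close> lies
  above the real part of a holomorphic polynomial plus \<open>\<epsilon> |z - z(p)|\<^sup>2\<close>, so \<open>f\<close> would peak there.
\<close>

section \<open>Metric on complex \<open>N\<close>-space\<close>

text \<open>An LACR function is merely continuous, whereas pseudoconvexity asks for a smooth
  function with positive complex Hessian. So pseudoconcavity is applied to holomorphic functions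
  only, and what is passed to the limit is the absence of peaks, a condition on moduli alone. The
  Gaussian decay makes it survive: a strict peak leaves a fixed gap between the centre and a small
  sphere around it, so a uniformly close function still has an interior maximum, though at another
  point. The factor \<open>G\<close> makes the condition independent of that point: moving the
  centre of a Gaussian changes it by a constant and by the modulus of the exponential of an affine
  holomorphic function. The same factor absorbs the pluriharmonic part of the Taylor polynomial of
  \<open>\<rho>\<close>, which is only C^2 and therefore cannot itself serve as the smooth function
  in the definition of pseudoconvexity. As \<open>peak_at\<close> quantifies existentially over
  local models, a peak is treated inside the chart in which it is given, and embeddings never have
  to be compared.\<close>

definition cdist :: "nat \<Rightarrow> (nat \<Rightarrow> complex) \<Rightarrow> (nat \<Rightarrow> complex) \<Rightarrow> real" where
  "cdist N z w = L2_set (\<lambda>i. cmod (z i - w i)) {..<N}"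

lemma cdist_square: "(cdist N z w)\<^sup>2 = (\<Sum>i<N. (cmod (z i - w i))\<^sup>2)"
  by (simp add: cdist_def L2_set_def sum_nonneg)

lemma cdist_nonneg [simp]: "0 \<le> cdist N z w"
  by (simp add: cdist_def)

lemma cdist_self [simp]: "cdist N z z = 0"
  by (simp add: cdist_def L2_set_def)

lemma cdist_triangle: "cdist N x z \<le> cdist N x y + cdist N y z"
proof -
  have "cdist N x z \<le> L2_set (\<lambda>i. cmod (x i - y i) + cmod (y i - z i)) {..<N}"
    unfolding cdist_def
    by (rule L2_set_mono) (auto intro: norm_diff_triangle_le)
  also have "\<dots> \<le> cdist N x y + cdist N y z"
    unfolding cdist_def by (rule L2_set_triangle_ineq)
  finally show ?thesis .
qed

lemma coord_le_cdist: "i < N \<Longrightarrow> cmod (z i - w i) \<le> cdist N z w"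
  unfolding cdist_def by (rule member_le_L2_set) auto

lemma cdist_mono:
  "(\<And>i. i < N \<Longrightarrow> cmod (z i - w i) \<le> cmod (z' i - w' i)) \<Longrightarrow> cdist N z w \<le> cdist N z' w'"
  unfolding cdist_def by (rule L2_set_mono) auto

lemma cdist_upd: "j < N \<Longrightarrow> cdist N (z(j := w)) z = cmod (w - z j)"
proof -
  assume "j < N"
  have "(\<Sum>i<N. (cmod ((z(j := w)) i - z i))\<^sup>2) = (\<Sum>i<N. if i = j then (cmod (w - z j))\<^sup>2 else 0)"
    by (rule sum.cong) auto
  then show ?thesis
    using \<open>j < N\<close> by (simp add: cdist_def L2_set_def)
qed

lemma cspace_upd [simp]: "j < N \<Longrightarrow> z \<in> cspace N \<Longrightarrow> z(j := w) \<in> cspace N"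
  by (auto simp: cspace_def)

lemma continuous_on_cdist: "continuous_on S (\<lambda>z. cdist N z w)"
  unfolding cdist_def L2_set_def
  by (intro continuous_intros continuous_on_subset [OF continuous_on_product_coordinates]) auto

text \<open>A basic open set of the product topology restricts coordinates by open sets, but those
  from \<open>N\<close> on are all \<open>0\<close> in \<open>cspace N\<close>, so a minimum over
  the first \<open>N\<close> radii is enough.\<close>

lemma open_cspace_nhd:
  assumes "open T" "p \<in> T" "p \<in> cspace N"
  obtains e where "0 < e" "\<And>z. z \<in> cspace N \<Longrightarrow> cdist N z p < e \<Longrightarrow> z \<in> T"
proof -
  have "openin (product_topology (\<lambda>i. euclidean) UNIV) T"
    using assms(1) by (simp add: euclidean_product_topology)
  then obtain B where B: "p \<in> Pi\<^sub>E UNIV B" "\<And>i. open (B i)" "Pi\<^sub>E UNIV B \<subseteq> T"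
    using product_topology_open_contains_basis [of "\<lambda>i. euclidean" UNIV T p] assms(2) by auto
  have "\<exists>e>0. \<forall>w. dist w (p i) < e \<longrightarrow> w \<in> B i" for i
    using B(1) B(2) [of i, unfolded open_dist] by auto
  then obtain e where e: "\<And>i. e i > 0" "\<And>i w. dist w (p i) < e i \<Longrightarrow> w \<in> B i"
    by metis
  \<comment> \<open>The inserted \<open>1\<close> keeps the minimum meaningful for
    \<open>N = 0\<close>.\<close>
  define d where "d = Min (insert 1 (e ` {..<N}))"
  have d: "0 < d" "\<And>i. i < N \<Longrightarrow> d \<le> e i"
    using e(1) by (auto simp: d_def)
  show thesis
  proof (rule that [OF d(1)])
    fix z assume z: "z \<in> cspace N" "cdist N z p < d"
    have "z i \<in> B i" for i
    proof (cases "i < N")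
      case True
      then have "dist (z i) (p i) < e i"
        using coord_le_cdist [OF True, of z p] z(2) d(2) [OF True] by (simp add: dist_norm)
      then show ?thesis by (rule e(2))
    next
      case False
      then have "z i = p i" using z(1) assms(3) by (simp add: cspace_def)
      then show ?thesis using B(1) by auto
    qed
    then show "z \<in> T" using B(3) by auto
  qed
qed

lemma open_in_cspace_iff:
  "open_in_cspace N U \<longleftrightarrow>
    U \<subseteq> cspace N \<and> (\<forall>p\<in>U. \<exists>e>0. \<forall>z\<in>cspace N. cdist N z p < e \<longrightarrow> z \<in> U)" (is "_ \<longleftrightarrow> ?R")
proof
  assume "open_in_cspace N U"
  then obtain T where T: "open T" "U = cspace N \<inter> T"
    by (auto simp: open_in_cspace_def openin_open)
  show ?R
  proof (intro conjI ballI)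
    show "U \<subseteq> cspace N" using T by auto
    fix p assume "p \<in> U"
    then obtain e where "e > 0" "\<And>z. z \<in> cspace N \<Longrightarrow> cdist N z p < e \<Longrightarrow> z \<in> T"
      using T open_cspace_nhd [of T p N] by blast
    then show "\<exists>e>0. \<forall>z\<in>cspace N. cdist N z p < e \<longrightarrow> z \<in> U"
      using T by blast
  qed
next
  assume R: ?R
  show "open_in_cspace N U"
    unfolding open_in_cspace_def
  proof (subst openin_subopen, intro ballI)
    fix p assume p: "p \<in> U"
    then obtain e where e: "e > 0" "\<forall>z\<in>cspace N. cdist N z p < e \<longrightarrow> z \<in> U" using R by blast
    have "open {z. cdist N z p < e}"
      by (rule open_Collect_less) (auto intro: continuous_on_cdist)
    then have "openin (top_of_set (cspace N)) (cspace N \<inter> {z. cdist N z p < e})"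
      by (rule openin_open_Int)
    moreover have "p \<in> cspace N \<inter> {z. cdist N z p < e}" using p R e by auto
    ultimately show "\<exists>T. openin (top_of_set (cspace N)) T \<and> p \<in> T \<and> T \<subseteq> U"
      using e by blast
  qed
qed

lemma open_in_cspace_subset: "open_in_cspace N U \<Longrightarrow> U \<subseteq> cspace N"
  by (simp add: open_in_cspace_iff)

lemma open_in_cspaceE:
  assumes "open_in_cspace N U" "p \<in> U"
  obtains e where "0 < e" "\<And>z. z \<in> cspace N \<Longrightarrow> cdist N z p < e \<Longrightarrow> z \<in> U"
  using assms by (meson open_in_cspace_iff)

lemma open_in_cspace_Int: "open_in_cspace N U \<Longrightarrow> open_in_cspace N V \<Longrightarrow> open_in_cspace N (U \<inter> V)"
  unfolding open_in_cspace_def by (rule openin_Int)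

lemma open_in_cspace_ball: "open_in_cspace N {z \<in> cspace N. cdist N z p < e}"
  unfolding open_in_cspace_iff
proof (intro conjI ballI)
  fix z assume z: "z \<in> {z \<in> cspace N. cdist N z p < e}"
  show "\<exists>d>0. \<forall>w\<in>cspace N. cdist N w z < d \<longrightarrow> w \<in> {z \<in> cspace N. cdist N z p < e}"
  proof (intro exI [of _ "e - cdist N z p"] conjI ballI impI)
    fix w assume "w \<in> cspace N" "cdist N w z < e - cdist N z p"
    then show "w \<in> {z \<in> cspace N. cdist N z p < e}"
      using cdist_triangle [of N w p z] by simp
  qed (use z in auto)
qed auto

lemma continuous_on_cspace_iff:
  assumes "U \<subseteq> cspace N"
  shows "continuous_on U F \<longleftrightarrow>
    (\<forall>p\<in>U. \<forall>e>0. \<exists>d>0. \<forall>z\<in>U. cdist N z p < d \<longrightarrow> dist (F z) (F p) < e)" (is "_ \<longleftrightarrow> ?R")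
proof
  assume c: "continuous_on U F"
  show ?R
  proof (intro ballI allI impI)
    fix p and e :: real assume p: "p \<in> U" and e: "e > 0"
    obtain T where T: "open T" "p \<in> T" "\<forall>z\<in>U. z \<in> T \<longrightarrow> F z \<in> ball (F p) e"
      using c [unfolded continuous_on_topological, rule_format, OF p open_ball, of "F p" e] e by auto
    obtain d where d: "0 < d" "\<And>z. z \<in> cspace N \<Longrightarrow> cdist N z p < d \<Longrightarrow> z \<in> T"
      using open_cspace_nhd [OF T(1,2), of N] p assms by blast
    then show "\<exists>d>0. \<forall>z\<in>U. cdist N z p < d \<longrightarrow> dist (F z) (F p) < e"
      using T(3) assms by (intro exI [of _ d]) (auto simp: dist_commute)
  qed
next
  assume R: ?R
  show "continuous_on U F"
    unfolding continuous_on_topological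
  proof (intro ballI allI impI)
    fix p B assume p: "p \<in> U" and B: "open B" "F p \<in> B"
    then obtain e where e: "e > 0" "\<And>y. dist y (F p) < e \<Longrightarrow> y \<in> B" unfolding open_dist by blast
    obtain d where d: "d > 0" "\<forall>z\<in>U. cdist N z p < d \<longrightarrow> dist (F z) (F p) < e" using R p e by blast
    have "open {z. cdist N z p < d}"
      by (rule open_Collect_less) (auto intro: continuous_on_cdist)
    then show "\<exists>T. open T \<and> p \<in> T \<and> (\<forall>z\<in>U. z \<in> T \<longrightarrow> F z \<in> B)"
      using d e by (intro exI [of _ "{z. cdist N z p < d}"]) auto
  qed
qed

text \<open>Heine-Borel by way of Tychonoff: the ball is a closed subset of a product of discs in
  the first \<open>N\<close> coordinates and of the singleton \<open>{0}\<close> in all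
  others.\<close>

lemma compact_cspace_cball: "compact {z \<in> cspace N. cdist N z p \<le> r}"
proof -
  define B where "B = (\<lambda>i. if i < N then cball (p i) r else {0::complex})"
  have "compactin (product_topology (\<lambda>i. euclidean) UNIV) (Pi\<^sub>E UNIV B)"
    by (auto simp: compactin_PiE B_def)
  then have "compact (Pi\<^sub>E UNIV B)" by (simp add: euclidean_product_topology)
  moreover have "closed {z. cdist N z p \<le> r}"
    by (rule closed_Collect_le) (auto intro: continuous_on_cdist)
  ultimately have "compact (Pi\<^sub>E UNIV B \<inter> {z. cdist N z p \<le> r})" by blast
  moreover have "{z \<in> cspace N. cdist N z p \<le> r} = Pi\<^sub>E UNIV B \<inter> {z. cdist N z p \<le> r}" (is "?L = ?R")
  proof
    show "?L \<subseteq> ?R"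
    proof
      fix z assume z: "z \<in> ?L"
      have "z i \<in> B i" for i
        using coord_le_cdist [of i N z p] z
        by (auto simp: B_def cspace_def dist_norm norm_minus_commute)
      then show "z \<in> ?R" using z by (auto simp: PiE_iff)
    qed
    show "?R \<subseteq> ?L"
    proof
      fix z assume z: "z \<in> ?R"
      have "z i = 0" if "N \<le> i" for i
        using PiE_mem [of z UNIV B i] z that by (simp add: B_def)
      then show "z \<in> ?L" using z by (simp add: cspace_def)
    qed
  qed
  ultimately show ?thesis by simp
qed

section \<open>Holomorphic functions of several variables\<close>

lemma holomorphic_inD:
  assumes "holomorphic_in N U F" "open_in_cspace N U" "z \<in> U" "j < N"
    and ball: "\<And>w. w \<in> cspace N \<Longrightarrow> cdist N w z < r \<Longrightarrow> w \<in> U"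
  shows "(\<lambda>w. F (z(j := w))) holomorphic_on ball (z j) r"
proof (rule holomorphic_onI)
  fix w assume w: "w \<in> ball (z j) r"
  have "z(j := w) \<in> U"
    using assms w open_in_cspace_subset [OF assms(2)]
    by (intro ball) (auto simp: cdist_upd dist_norm norm_minus_commute)
  then have "(\<lambda>v. F ((z(j := w))(j := v))) field_differentiable at ((z(j := w)) j)"
    using assms(1) \<open>j < N\<close> unfolding holomorphic_in_def by blast
  then show "(\<lambda>w. F (z(j := w))) field_differentiable at w within ball (z j) r"
    by (simp add: field_differentiable_at_within)
qed

text \<open>Taylor's formula of order one, with the second derivative bounded by Cauchy's estimate
  on discs of radius \<open>r / 2\<close>; hence the constant
  \<open>2 * (B + 1) / (r / 2)\<^sup>2\<close>. It depends on \<open>B\<close> and \<open>r\<close>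
  only, so difference quotients converge uniformly in the remaining variables.\<close>

lemma difference_quotient_bound:
  assumes hol: "\<phi> holomorphic_on ball a r" and "0 < r"
    and B: "\<And>w. w \<in> ball a r \<Longrightarrow> cmod (\<phi> w) \<le> B"
    and s: "s \<noteq> 0" "cmod s \<le> r / 4"
  shows "cmod ((\<phi> (a + s) - \<phi> a) / s - deriv \<phi> a) \<le> 8 * (B + 1) / r\<^sup>2 * cmod s"
proof -
  let ?S = "cball a (r / 4)"
  have d: "(((deriv ^^ i) \<phi>) has_field_derivative (deriv ^^ (Suc i)) \<phi> x) (at x within ?S)"
    if "x \<in> ?S" for i x
  proof -
    have "(deriv ^^ i) \<phi> holomorphic_on ball a r"
      by (rule holomorphic_higher_deriv [OF hol]) auto
    moreover have "x \<in> ball a r" using that \<open>0 < r\<close> by auto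
    ultimately have "((deriv ^^ i) \<phi> has_field_derivative deriv ((deriv ^^ i) \<phi>) x) (at x)"
      by (meson holomorphic_derivI open_ball)
    then show ?thesis by (simp add: has_field_derivative_at_within)
  qed
  have b: "cmod ((deriv ^^ 2) \<phi> x) \<le> 8 * (B + 1) / r\<^sup>2" if "x \<in> ?S" for x
  proof -
    have sub: "cball x (r / 2) \<subseteq> ball a r"
    proof
      fix y assume "y \<in> cball x (r / 2)"
      then show "y \<in> ball a r"
        using that \<open>0 < r\<close> dist_triangle [of a y x] by auto
    qed
    \<comment> \<open>Cauchy's estimate asks for values in an open ball, hence \<open>B + 1\<close>
      instead of \<open>B\<close>.\<close>
    have "cmod ((deriv ^^ 2) \<phi> x) \<le> fact 2 * (B + 1) / (r / 2)\<^sup>2"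
    proof (rule Cauchy_higher_deriv_bound [where y = 0])
      show "\<phi> holomorphic_on ball x (r / 2)"
        using hol sub by (meson ball_subset_cball holomorphic_on_subset)
      show "continuous_on (cball x (r / 2)) \<phi>"
        using hol sub by (meson holomorphic_on_imp_continuous_on continuous_on_subset)
      show "\<phi> w \<in> ball 0 (B + 1)" if "w \<in> ball x (r / 2)" for w
        using B [of w] sub that ball_subset_cball by fastforce
    qed (use \<open>0 < r\<close> in auto)
    then show ?thesis using \<open>0 < r\<close> by (simp add: power_divide field_simps)
  qed
  have "cmod ((deriv ^^ 0) \<phi> (a + s) - (\<Sum>i\<le>1. (deriv ^^ i) \<phi> a * (a + s - a) ^ i / fact i))
      \<le> (8 * (B + 1) / r\<^sup>2) * cmod (a + s - a) ^ Suc 1 / fact 1"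
    by (rule complex_Taylor [of ?S 1]) (use d b s \<open>0 < r\<close> in \<open>auto simp: numeral_2_eq_2 dist_norm\<close>)
  then have *: "cmod (\<phi> (a + s) - \<phi> a - deriv \<phi> a * s) \<le> 8 * (B + 1) / r\<^sup>2 * (cmod s)\<^sup>2"
    by (simp add: power2_eq_square algebra_simps)
  have "(\<phi> (a + s) - \<phi> a) / s - deriv \<phi> a = (\<phi> (a + s) - \<phi> a - deriv \<phi> a * s) / s"
    using s(1) by (simp add: field_simps)
  then have "cmod ((\<phi> (a + s) - \<phi> a) / s - deriv \<phi> a) = cmod (\<phi> (a + s) - \<phi> a - deriv \<phi> a * s) / cmod s"
    by (simp add: norm_divide)
  also have "\<dots> \<le> (8 * (B + 1) / r\<^sup>2 * (cmod s)\<^sup>2) / cmod s"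
    by (rule divide_right_mono [OF *]) simp
  also have "\<dots> = 8 * (B + 1) / r\<^sup>2 * cmod s"
    using s(1) by (simp add: power2_eq_square)
  finally show ?thesis .
qed

lemma holomorphic_in_subset: "holomorphic_in N U F \<Longrightarrow> V \<subseteq> U \<Longrightarrow> holomorphic_in N V F"
  unfolding holomorphic_in_def by (meson continuous_on_subset subsetD)

text \<open>Weierstrass' theorem. Each coordinate slice is a one-variable uniform limit on a disc;
  joint continuity comes from the uniform limit theorem and is glued over neighbourhoods that vary
  with the point.\<close>

lemma holomorphic_in_locally_uniform_limit:
  assumes U: "open_in_cspace N U"
    and lim: "\<And>p. p \<in> U \<Longrightarrow> \<exists>V q. open_in_cspace N V \<and> p \<in> V \<and> V \<subseteq> U \<and>
        (\<forall>\<^sub>F n in sequentially. holomorphic_in N V (q n)) \<and> uniform_limit V q F sequentially"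
  shows "holomorphic_in N U F"
  unfolding holomorphic_in_def
proof (intro conjI ballI allI impI)
  have "\<exists>T. open T \<and> p \<in> T \<and> continuous_on (U \<inter> T) F" if p: "p \<in> U" for p
  proof -
    obtain V q where V: "open_in_cspace N V" "p \<in> V" "V \<subseteq> U"
      and q: "\<forall>\<^sub>F n in sequentially. holomorphic_in N V (q n)" "uniform_limit V q F sequentially"
      using lim [OF p] by blast
    have "continuous_on V F"
      by (rule uniform_limit_theorem [OF _ q(2)])
        (use q(1) in \<open>auto simp: holomorphic_in_def elim: eventually_mono\<close>)
    moreover obtain T where "open T" "V = cspace N \<inter> T"
      using V(1) by (auto simp: open_in_cspace_def openin_open)
    ultimately show ?thesis
      using V U by (intro exI [of _ T] conjI)
        (auto simp: open_in_cspace_iff intro: continuous_on_subset)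
  qed
  then have T: "\<And>p. p \<in> U \<Longrightarrow> \<exists>T. open T \<and> p \<in> T \<and> continuous_on (U \<inter> T) F" .
  show "continuous_on U F"
    unfolding continuous_on_topological
  proof (intro ballI allI impI)
    fix p B assume p: "p \<in> U" and B: "open B" "F p \<in> B"
    obtain T where "open T" "p \<in> T" "continuous_on (U \<inter> T) F" using T [OF p] by blast
    moreover from this obtain S where "open S" "p \<in> S" "\<forall>y\<in>U \<inter> T. y \<in> S \<longrightarrow> F y \<in> B"
      using p B unfolding continuous_on_topological by (metis IntI)
    ultimately show "\<exists>S. open S \<and> p \<in> S \<and> (\<forall>y\<in>U. y \<in> S \<longrightarrow> F y \<in> B)"
      by (intro exI [of _ "S \<inter> T"]) auto
  qed
next
  fix p j assume p: "p \<in> U" and j: "j < N"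
  obtain V q where V: "open_in_cspace N V" "p \<in> V" "V \<subseteq> U"
    and q: "\<forall>\<^sub>F n in sequentially. holomorphic_in N V (q n)" "uniform_limit V q F sequentially"
    using lim [OF p] by blast
  obtain e where e: "0 < e" "\<And>w. w \<in> cspace N \<Longrightarrow> cdist N w p < e \<Longrightarrow> w \<in> V"
    using open_in_cspaceE [OF V(1,2)] by blast
  have inV: "p(j := w) \<in> V" if "w \<in> cball (p j) (e / 2)" for w
    using that e(1) V j open_in_cspace_subset [OF V(1)]
    by (intro e(2)) (auto simp: cdist_upd dist_norm norm_minus_commute)
  have ev: "\<forall>\<^sub>F n in sequentially. continuous_on (cball (p j) (e / 2)) (\<lambda>w. q n (p(j := w))) \<and>
      (\<lambda>w. q n (p(j := w))) holomorphic_on ball (p j) (e / 2)"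
    using q(1)
  proof eventually_elim
    case (elim n)
    have h: "(\<lambda>w. q n (p(j := w))) holomorphic_on ball (p j) e"
      by (rule holomorphic_inD [OF elim V(1,2) j e(2)])
    have "cball (p j) (e / 2) \<subseteq> ball (p j) e" using e(1) by auto
    then show ?case
      using h by (meson ball_subset_cball holomorphic_on_imp_continuous_on holomorphic_on_subset
          subset_trans continuous_on_subset)
  qed
  have ul: "uniform_limit (cball (p j) (e / 2)) (\<lambda>n w. q n (p(j := w))) (\<lambda>w. F (p(j := w))) sequentially"
    unfolding uniform_limit_iff
  proof (intro allI impI)
    fix d :: real assume "d > 0"
    then have "\<forall>\<^sub>F n in sequentially. \<forall>x\<in>V. dist (q n x) (F x) < d"
      using q(2) unfolding uniform_limit_iff by blast
    then show "\<forall>\<^sub>F n in sequentially. \<forall>w\<in>cball (p j) (e / 2). dist (q n (p(j := w))) (F (p(j := w))) < d"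
      by eventually_elim (use inV in blast)
  qed
  have "(\<lambda>w. F (p(j := w))) holomorphic_on ball (p j) (e / 2)"
    by (rule holomorphic_uniform_limit [OF ev ul]) auto
  then show "(\<lambda>w. F (p(j := w))) field_differentiable at (p j)"
    using e(1) by (simp add: holomorphic_on_imp_differentiable_at)
qed

definition cderiv :: "nat \<Rightarrow> ((nat \<Rightarrow> complex) \<Rightarrow> complex) \<Rightarrow> (nat \<Rightarrow> complex) \<Rightarrow> complex" where
  "cderiv j F z = deriv (\<lambda>w. F (z(j := w))) (z j)"

lemma holomorphic_in_shift:
  assumes "holomorphic_in N U F" "open_in_cspace N U" "V \<subseteq> cspace N" "j < N"
    and shift: "\<And>z. z \<in> V \<Longrightarrow> z(j := z j + s) \<in> U"
  shows "holomorphic_in N V (\<lambda>z. F (z(j := z j + s)))"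
  unfolding holomorphic_in_def
proof (intro conjI ballI allI impI)
  have c: "continuous_on V (\<lambda>z. z(j := z j + s))"
  proof (rule continuous_on_coordinatewise_then_product)
    fix i show "continuous_on V (\<lambda>z. (z(j := z j + s)) i)"
      by (cases "i = j")
        (auto intro!: continuous_intros continuous_on_subset [OF continuous_on_product_coordinates])
  qed
  have "continuous_on U F" using assms(1) by (simp add: holomorphic_in_def)
  then show "continuous_on V (\<lambda>z. F (z(j := z j + s)))"
    by (rule continuous_on_compose2 [OF _ c]) (use shift in auto)
next
  fix z k assume z: "z \<in> V" and k: "k < N"
  have fd: "(\<lambda>w. F ((z(j := z j + s))(k := w))) field_differentiable at ((z(j := z j + s)) k)"
    using assms(1) shift [OF z] k unfolding holomorphic_in_def by blast
  show "(\<lambda>w. F ((z(k := w))(j := (z(k := w)) j + s))) field_differentiable at (z k)"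
  proof (cases "k = j")
    case True
    have "((\<lambda>w. F ((z(j := z j + s))(k := w))) \<circ> (\<lambda>w. w + s)) field_differentiable at (z j)"
      by (rule field_differentiable_compose)
        (use fd True in \<open>auto intro!: derivative_intros simp: field_differentiable_add\<close>)
    then show ?thesis using True by (simp add: o_def)
  next
    case False
    then have "(\<lambda>w. F ((z(k := w))(j := (z(k := w)) j + s))) = (\<lambda>w. F ((z(j := z j + s))(k := w)))"
      by (auto simp: fun_upd_twist)
    then show ?thesis using fd False by simp
  qed
qed

section \<open>Algebra of holomorphic functions and their partial derivatives\<close>

lemma holomorphic_in_diff:
  "holomorphic_in N U F \<Longrightarrow> holomorphic_in N U G \<Longrightarrow> holomorphic_in N U (\<lambda>z. F z - G z)"
  unfolding holomorphic_in_def by (auto intro!: continuous_intros field_differentiable_diff)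

lemma holomorphic_in_add:
  "holomorphic_in N U F \<Longrightarrow> holomorphic_in N U G \<Longrightarrow> holomorphic_in N U (\<lambda>z. F z + G z)"
  unfolding holomorphic_in_def by (auto intro!: continuous_intros field_differentiable_add)

lemma holomorphic_in_mult:
  "holomorphic_in N U F \<Longrightarrow> holomorphic_in N U G \<Longrightarrow> holomorphic_in N U (\<lambda>z. F z * G z)"
  unfolding holomorphic_in_def by (auto intro!: continuous_intros field_differentiable_mult)

lemma holomorphic_in_const: "holomorphic_in N U (\<lambda>z. c)"
  unfolding holomorphic_in_def by auto

lemma holomorphic_in_coord: "holomorphic_in N U (\<lambda>z. z i)"
  unfolding holomorphic_in_def
proof (intro conjI ballI allI impI)
  show "continuous_on U (\<lambda>z. z i)"
    by (rule continuous_on_subset [OF continuous_on_product_coordinates]) auto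
  show "(\<lambda>w. (z(j := w)) i) field_differentiable at (z j)" for z j
    by (cases "i = j") (auto simp: field_differentiable_ident)
qed

lemma holomorphic_in_sum:
  "(\<And>i. i \<in> I \<Longrightarrow> holomorphic_in N U (F i)) \<Longrightarrow> holomorphic_in N U (\<lambda>z. \<Sum>i\<in>I. F i z)"
  by (induction I rule: infinite_finite_induct) (auto intro: holomorphic_in_add holomorphic_in_const)

lemma holomorphic_in_exp:
  assumes "holomorphic_in N U F" shows "holomorphic_in N U (\<lambda>z. exp (F z))"
  unfolding holomorphic_in_def
proof (intro conjI ballI allI impI)
  show "continuous_on U (\<lambda>z. exp (F z))"
    using assms by (auto simp: holomorphic_in_def intro!: continuous_intros)
  fix z j assume "z \<in> U" "j < N"
  then have "(exp \<circ> (\<lambda>w. F (z(j := w)))) field_differentiable at (z j)"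
    using assms by (intro field_differentiable_compose)
      (auto simp: holomorphic_in_def field_differentiable_within_exp)
  then show "(\<lambda>w. exp (F (z(j := w)))) field_differentiable at (z j)"
    by (simp add: o_def)
qed

lemmas holomorphic_in_intros =
  holomorphic_in_diff holomorphic_in_add holomorphic_in_mult holomorphic_in_const
  holomorphic_in_coord holomorphic_in_sum holomorphic_in_exp

text \<open>One-variable theory gives holomorphy of \<open>cderiv j F\<close> in coordinate
  \<open>j\<close> only. As a locally uniform limit of difference quotients, which are holomorphic
  in all coordinates, it is jointly continuous and holomorphic in each.\<close>

lemma holomorphic_in_cderiv:
  assumes F: "holomorphic_in N U F" and U: "open_in_cspace N U" and j: "j < N"
  shows "holomorphic_in N U (cderiv j F)"
proof (rule holomorphic_in_locally_uniform_limit [OF U])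
  fix p assume p: "p \<in> U"
  have cont: "continuous_on U F" using F by (simp add: holomorphic_in_def)
  obtain e where e: "0 < e" "\<And>z. z \<in> cspace N \<Longrightarrow> cdist N z p < e \<Longrightarrow> z \<in> U"
    using open_in_cspaceE [OF U p] by blast
  obtain d where d: "0 < d" "\<And>z. z \<in> U \<Longrightarrow> cdist N z p < d \<Longrightarrow> dist (F z) (F p) < 1"
    using cont [unfolded continuous_on_cspace_iff [OF open_in_cspace_subset [OF U]], rule_format, OF p, of 1]
    by auto
  \<comment> \<open>Half the common radius: a point within \<open>r\<close> of a point of
    \<open>V\<close> is within \<open>2 * r\<close> of \<open>p\<close>, hence lies in
    \<open>U\<close> and has \<open>cmod (F w) \<le> B\<close>.\<close>
  define r where "r = min e d / 2"
  have r: "0 < r" using e d by (simp add: r_def)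
  define V where "V = {z \<in> cspace N. cdist N z p < r}"
  have V: "open_in_cspace N V" unfolding V_def by (rule open_in_cspace_ball)
  define B where "B = cmod (F p) + 1"
  have near: "w \<in> U" "cmod (F w) \<le> B" if "z \<in> V" "w \<in> cspace N" "cdist N w z < r" for z w
  proof -
    have "cdist N w p < 2 * r"
      using cdist_triangle [of N w p z] that by (simp add: V_def)
    then have "cdist N w p < e" "cdist N w p < d" by (simp_all add: r_def)
    then show "w \<in> U" using e that by blast
    then have "dist (F w) (F p) < 1" using d \<open>cdist N w p < d\<close> by blast
    then show "cmod (F w) \<le> B"
      using norm_triangle_sub [of "F w" "F p"] by (simp add: B_def dist_norm)
  qed
  have VU: "V \<subseteq> U"
    using near(1) r unfolding V_def by auto
  \<comment> \<open>The increments tend to \<open>0\<close> and never exceed \<open>r / 4\<close>,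
    the range allowed by \<open>difference_quotient_bound\<close>.\<close>
  define s where "s = (\<lambda>n. complex_of_real (r / (4 * real (Suc n))))"
  define q where "q = (\<lambda>n z. (F (z(j := z j + s n)) - F z) * (1 / s n))"
  have s: "s n \<noteq> 0" "cmod (s n) = r / (4 * real (Suc n))" "cmod (s n) \<le> r / 4" "cmod (s n) < r" for n
  proof -
    show "s n \<noteq> 0" using r unfolding s_def of_real_eq_0_iff by (simp del: of_nat_Suc)
    show 1: "cmod (s n) = r / (4 * real (Suc n))"
      using r unfolding s_def norm_of_real by (simp del: of_nat_Suc)
    have "r / (4 * real (Suc n)) \<le> r / 4"
      using r by (intro divide_left_mono) auto
    with 1 show "cmod (s n) \<le> r / 4" by linarith
    with r show "cmod (s n) < r" by linarith
  qed
  have "holomorphic_in N V (q n)" for n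
    unfolding q_def
  proof (intro holomorphic_in_mult holomorphic_in_diff holomorphic_in_const)
    show "holomorphic_in N V (\<lambda>z. F (z(j := z j + s n)))"
    proof (rule holomorphic_in_shift [OF F U _ j])
      show "V \<subseteq> cspace N" by (auto simp: V_def)
      fix z assume "z \<in> V"
      then show "z(j := z j + s n) \<in> U"
        by (rule near(1)) (use s j \<open>z \<in> V\<close> in \<open>auto simp: V_def cdist_upd\<close>)
    qed
    show "holomorphic_in N V F" by (rule holomorphic_in_subset [OF F VU])
  qed
  moreover have "uniform_limit V q (cderiv j F) sequentially"
    unfolding uniform_limit_iff
  proof (intro allI impI)
    fix \<epsilon> :: real assume "\<epsilon> > 0"
    have est: "dist (q n z) (cderiv j F z) \<le> 8 * (B + 1) / r\<^sup>2 * cmod (s n)" if z: "z \<in> V" for n z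
    proof -
      have h: "(\<lambda>w. F (z(j := w))) holomorphic_on ball (z j) r"
        by (rule holomorphic_inD [OF F U _ j]) (use VU z near(1) in auto)
      have "cmod ((F (z(j := z j + s n)) - F (z(j := z j))) / s n - deriv (\<lambda>w. F (z(j := w))) (z j))
          \<le> 8 * (B + 1) / r\<^sup>2 * cmod (s n)"
      proof (rule difference_quotient_bound [OF h r _ s(1) s(3)])
        fix w assume "w \<in> ball (z j) r"
        then show "cmod (F (z(j := w))) \<le> B"
          using z j by (intro near(2) [OF z])
            (auto simp: V_def cdist_upd dist_norm norm_minus_commute)
      qed
      then show ?thesis by (simp add: dist_norm q_def cderiv_def)
    qed
    have "(\<lambda>n. 8 * (B + 1) / r\<^sup>2 * cmod (s n)) \<longlonglongrightarrow> 0"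
    proof (rule tendsto_mult_right_zero)
      have "(\<lambda>n. r / 4 * inverse (real (Suc n))) \<longlonglongrightarrow> 0"
        by (rule tendsto_mult_right_zero [OF LIMSEQ_inverse_real_of_nat])
      then show "(\<lambda>n. cmod (s n)) \<longlonglongrightarrow> 0"
        unfolding s(2) by (simp add: divide_simps)
    qed
    then have "\<forall>\<^sub>F n in sequentially. 8 * (B + 1) / r\<^sup>2 * cmod (s n) < \<epsilon>"
      using \<open>\<epsilon> > 0\<close> by (simp add: order_tendstoD(2))
    then show "\<forall>\<^sub>F n in sequentially. \<forall>z\<in>V. dist (q n z) (cderiv j F z) < \<epsilon>"
      by eventually_elim (meson est le_less_trans)
  qed
  moreover have "p \<in> V"
    using p r open_in_cspace_subset [OF U] by (auto simp: V_def)
  ultimately show "\<exists>V q. open_in_cspace N V \<and> p \<in> V \<and> V \<subseteq> U \<and>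
      (\<forall>\<^sub>F n in sequentially. holomorphic_in N V (q n)) \<and> uniform_limit V q (cderiv j F) sequentially"
    using V VU by (intro exI [of _ V] exI [of _ q]) auto
qed

section \<open>Smoothness and complex Hessian\<close>

lemma curve_0 [simp]: "curve z j d 0 = z"
  by (simp add: curve_def)

lemma curve_in_cspace [simp]: "j < N \<Longrightarrow> z \<in> cspace N \<Longrightarrow> curve z j d t \<in> cspace N"
  by (simp add: curve_def)

lemma curve_curve: "curve (curve z j d s) j d t = curve z j d (s + t)"
  by (simp add: curve_def algebra_simps)

lemma eventually_curve_in:
  assumes "open_in_cspace N U" "z \<in> U" "j < N"
  shows "\<forall>\<^sub>F t in nhds 0. curve z j d t \<in> U"
proof -
  obtain e where e: "0 < e" "\<And>w. w \<in> cspace N \<Longrightarrow> cdist N w z < e \<Longrightarrow> w \<in> U"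
    using open_in_cspaceE [OF assms(1,2)] by blast
  have "((\<lambda>t. \<bar>t\<bar> * cmod d) \<longlongrightarrow> \<bar>0\<bar> * cmod d) (nhds (0::real))"
    by (intro tendsto_intros filterlim_ident)
  then have "\<forall>\<^sub>F t in nhds (0::real). \<bar>t\<bar> * cmod d < e"
    using e(1) by (intro order_tendstoD(2)) auto
  then show ?thesis
  proof eventually_elim
    case (elim t)
    then show ?case
      using open_in_cspace_subset [OF assms(1)] assms(2,3)
      by (intro e(2)) (auto simp: curve_def cdist_upd norm_mult)
  qed
qed

lemma has_vector_derivative_curve_cong:
  assumes "open_in_cspace N U" "z \<in> U" "j < N" "\<And>w. w \<in> U \<Longrightarrow> F w = G w"
  shows "((\<lambda>t. F (curve z j d t)) has_vector_derivative D) (at 0) \<longleftrightarrow>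
    ((\<lambda>t. G (curve z j d t)) has_vector_derivative D) (at 0)"
proof (rule has_vector_derivative_cong_ev)
  show "\<forall>\<^sub>F t in nhds 0. t \<in> UNIV \<longrightarrow> F (curve z j d t) = G (curve z j d t)"
    using eventually_curve_in [OF assms(1-3), of d] by eventually_elim (simp add: assms(4))
qed (simp add: assms)

text \<open>\<open>vector_derivative\<close> chooses from the set of derivatives, and the two
  functions agree along the curve near parameter \<open>0\<close>, so both choices are made from the
  same set, empty or not.\<close>

lemma partial_deriv_cong:
  assumes "open_in_cspace N U" "z \<in> U" "j < N" "\<And>w. w \<in> U \<Longrightarrow> F w = G w"
  shows "partial_deriv j d F z = partial_deriv j d G z"
proof -
  have "((\<lambda>t. F (curve z j d t)) has_vector_derivative D) (at 0) \<longleftrightarrow>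
    ((\<lambda>t. G (curve z j d t)) has_vector_derivative D) (at 0)" for D
    by (rule has_vector_derivative_curve_cong [OF assms])
  then show ?thesis
    by (simp add: partial_deriv_def vector_derivative_def)
qed

lemma differentiable_curve_cong:
  assumes "open_in_cspace N U" "z \<in> U" "j < N" "\<And>w. w \<in> U \<Longrightarrow> F w = G w"
  shows "(\<lambda>t. F (curve z j d t)) differentiable at 0 \<longleftrightarrow> (\<lambda>t. G (curve z j d t)) differentiable at 0"
proof -
  have "((\<lambda>t. F (curve z j d t)) has_vector_derivative D) (at 0) \<longleftrightarrow>
    ((\<lambda>t. G (curve z j d t)) has_vector_derivative D) (at 0)" for D
    by (rule has_vector_derivative_curve_cong [OF assms])
  then show ?thesis
    by (auto simp: vector_derivative_works vector_derivative_def)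
qed

text \<open>Derivatives are computed by formulas valid only on \<open>U\<close>, while
  \<open>C_k\<close> iterates \<open>partial_deriv\<close> on total functions; this lets such a
  formula replace a partial derivative under \<open>C_k\<close>.\<close>

lemma C_k_cong:
  assumes "open_in_cspace N U" "\<And>w. w \<in> U \<Longrightarrow> F w = G w"
  shows "C_k k N U F \<longleftrightarrow> C_k k N U G"
  using assms(2)
proof (induction k arbitrary: F G)
  case 0
  then show ?case by (simp cong: continuous_on_cong)
next
  case (Suc k)
  have "continuous_on U F \<longleftrightarrow> continuous_on U G"
    by (rule continuous_on_cong) (use Suc.prems in auto)
  moreover have "C_k k N U (partial_deriv j d F) \<longleftrightarrow> C_k k N U (partial_deriv j d G)" if "j < N" for j d
    by (rule Suc.IH) (rule partial_deriv_cong [OF assms(1) _ that Suc.prems])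
  moreover have "(\<lambda>t. F (curve z j d t)) differentiable at 0 \<longleftrightarrow> (\<lambda>t. G (curve z j d t)) differentiable at 0"
    if "j < N" "z \<in> U" for j d z
    by (rule differentiable_curve_cong [OF assms(1) that(2,1) Suc.prems])
  ultimately show ?case by (simp cong: ball_cong)
qed

lemma C_k_transfer:
  "open_in_cspace N U \<Longrightarrow> C_k k N U G \<Longrightarrow> (\<And>w. w \<in> U \<Longrightarrow> F w = G w) \<Longrightarrow> C_k k N U F"
  using C_k_cong [of N U F G k] by simp

lemma has_vector_derivative_partial_deriv:
  assumes "(\<lambda>t. F (curve z j d t)) differentiable at 0"
  shows "((\<lambda>t. F (curve z j d t)) has_vector_derivative partial_deriv j d F z) (at 0)"
  using assms by (simp add: partial_deriv_def vector_derivative_works)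

lemma partial_derivI:
  assumes "((\<lambda>t. F (curve z j d t)) has_vector_derivative D) (at 0)"
  shows "partial_deriv j d F z = D"
  using assms by (simp add: partial_deriv_def vector_derivative_at)

section \<open>Real parts of holomorphic functions plus squared distances\<close>

lemma has_vector_derivative_curve_holomorphic:
  assumes "holomorphic_in N U G" "z \<in> U" "j < N"
  shows "((\<lambda>t. G (curve z j d t)) has_vector_derivative d * cderiv j G z) (at 0)"
proof -
  have "((\<lambda>t. z j + of_real t * d) has_vector_derivative d) (at 0)"
    by (auto intro!: derivative_eq_intros)
  moreover have "(\<lambda>w. G (z(j := w))) field_differentiable at (z j)"
    using assms unfolding holomorphic_in_def by blast
  then have "((\<lambda>w. G (z(j := w))) has_field_derivative cderiv j G z) (at (z j + of_real 0 * d))"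
    unfolding cderiv_def by (simp add: field_differentiable_derivI)
  ultimately have "((\<lambda>w. G (z(j := w))) \<circ> (\<lambda>t. z j + of_real t * d) has_vector_derivative d * cderiv j G z) (at 0)"
    by (rule field_vector_diff_chain_at)
  then show ?thesis by (simp add: o_def curve_def)
qed

lemma has_vector_derivative_curve_Re:
  assumes "holomorphic_in N U G" "z \<in> U" "j < N"
  shows "((\<lambda>t. Re (G (curve z j d t))) has_vector_derivative Re (d * cderiv j G z)) (at 0)"
  by (rule bounded_linear.has_vector_derivative
      [OF bounded_linear_Re has_vector_derivative_curve_holomorphic [OF assms]])

text \<open>The class is closed under differentiation: the derivative of \<open>Re G\<close> in
  direction \<open>d\<close> is \<open>Re (d * cderiv j G)\<close>, again the real part of a
  holomorphic function, so the induction runs over all \<open>G\<close>.\<close>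

lemma C_k_Re:
  assumes "open_in_cspace N U" "holomorphic_in N U G"
  shows "C_k k N U (\<lambda>z. Re (G z))"
  using assms(2)
proof (induction k arbitrary: G)
  case 0
  then show ?case by (auto simp: holomorphic_in_def intro!: continuous_intros)
next
  case (Suc k)
  have "C_k k N U (partial_deriv j d (\<lambda>z. Re (G z)))" if j: "j < N" for j d
  proof -
    have "C_k k N U (\<lambda>z. Re (d * cderiv j G z))"
      using Suc.prems assms(1) j
      by (intro Suc.IH holomorphic_in_intros holomorphic_in_cderiv)
    moreover have "partial_deriv j d (\<lambda>z. Re (G z)) z = Re (d * cderiv j G z)" if "z \<in> U" for z
      by (rule partial_derivI [OF has_vector_derivative_curve_Re [OF Suc.prems that j]])
    ultimately show ?thesis by (rule C_k_transfer [OF assms(1)])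
  qed
  moreover have "continuous_on U (\<lambda>z. Re (G z))"
    using Suc.prems by (auto simp: holomorphic_in_def intro!: continuous_intros)
  moreover have "(\<lambda>t. Re (G (curve z j d t))) differentiable at 0" if "z \<in> U" "j < N" for z j d
    using has_vector_derivative_curve_Re [OF Suc.prems that] differentiableI_vector by blast
  ultimately show ?case by auto
qed

lemma has_vector_derivative_curve_cdist:
  assumes "j < N"
  shows "((\<lambda>t. (cdist N (curve z j d t) p)\<^sup>2) has_vector_derivative Re (2 * cnj d * (z j - p j))) (at 0)"
proof -
  have "(cdist N (curve z j d t) p)\<^sup>2 =
      (cdist N z p)\<^sup>2 + (t * Re (2 * cnj d * (z j - p j)) + t\<^sup>2 * (cmod d)\<^sup>2)" for t
  proof -
    have "(cmod (curve z j d t i - p i))\<^sup>2 = (cmod (z i - p i))\<^sup>2 +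
        (if i = j then t * Re (2 * cnj d * (z j - p j)) + t\<^sup>2 * (cmod d)\<^sup>2 else 0)" for i
      by (cases "i = j"; simp add: curve_def cmod_power2; simp add: power2_eq_square algebra_simps)
    then show ?thesis
      using assms by (simp add: cdist_square sum.distrib)
  qed
  then show ?thesis
    unfolding has_real_derivative_iff_has_vector_derivative [symmetric]
    by (auto intro!: derivative_eq_intros)
qed

text \<open>Adding \<open>c |z - p|\<^sup>2\<close> to the real part of a holomorphic function gives a smooth function whose
  first partial derivatives are again real parts of holomorphic functions.\<close>

lemma has_vector_derivative_curve_Re_cdist:
  assumes "holomorphic_in N U G" "z \<in> U" "j < N"
  shows "((\<lambda>t. Re (G (curve z j d t)) + c * (cdist N (curve z j d t) p)\<^sup>2) has_vector_derivative
    Re (d * cderiv j G z + 2 * of_real c * cnj d * (z j - p j))) (at 0)"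
  using has_vector_derivative_add [OF has_vector_derivative_curve_Re [OF assms, of d]
      has_vector_derivative_mult_right [OF has_vector_derivative_curve_cdist [OF assms(3), of z d p], of c]]
  by (simp add: algebra_simps)

lemma C_infinity_Re_cdist:
  assumes U: "open_in_cspace N U" and G: "holomorphic_in N U G"
  shows "C_infinity N U (\<lambda>z. Re (G z) + c * (cdist N z p)\<^sup>2)"
  unfolding C_infinity_def
proof
  fix k
  let ?F = "\<lambda>z. Re (G z) + c * (cdist N z p)\<^sup>2"
  have cont: "continuous_on U ?F"
    using G by (auto simp: holomorphic_in_def intro!: continuous_intros continuous_on_cdist)
  show "C_k k N U ?F"
  proof (cases k)
    case 0
    then show ?thesis using cont by simp
  next
    case (Suc m)
    have "C_k m N U (partial_deriv j d ?F)" if j: "j < N" for j d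
    proof -
      have "C_k m N U (\<lambda>z. Re (d * cderiv j G z + 2 * of_real c * cnj d * (z j - p j)))"
        by (intro C_k_Re U holomorphic_in_intros holomorphic_in_cderiv G j)
      moreover have "partial_deriv j d ?F z = Re (d * cderiv j G z + 2 * of_real c * cnj d * (z j - p j))"
        if "z \<in> U" for z
        by (rule partial_derivI [OF has_vector_derivative_curve_Re_cdist [OF G that j]])
      ultimately show ?thesis by (rule C_k_transfer [OF U])
    qed
    moreover have "(\<lambda>t. ?F (curve z j d t)) differentiable at 0" if "z \<in> U" "j < N" for z j d
      using has_vector_derivative_curve_Re_cdist [OF G that] differentiableI_vector by blast
    ultimately show ?thesis using Suc cont by auto
  qed
qed

text \<open>Rewrites an entry of the Levi matrix in iterated real partial derivatives, the form in
  which the Taylor expansion produces them. The operators \<open>wirtinger\<close> and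
  \<open>wirtinger_bar\<close> act on the complexified function, so each real derivative has to be
  moved through \<open>of_real\<close>.\<close>

lemma complex_hessian_entry:
  assumes U: "open_in_cspace N U" and F: "C_k 2 N U F" and z: "z \<in> U" and ij: "i < N" "j < N"
  shows "complex_hessian N F z $$ (i, j) =
    of_real ((partial_deriv i 1 (partial_deriv j 1 F) z + partial_deriv i \<i> (partial_deriv j \<i> F) z) / 4) +
    \<i> * of_real ((partial_deriv i 1 (partial_deriv j \<i> F) z - partial_deriv i \<i> (partial_deriv j 1 F) z) / 4)"
proof -
  have d1: "(\<lambda>t. F (curve w j d t)) differentiable at 0" if "w \<in> U" "d \<in> {1, \<i>}" for w d
    using F that ij by (auto simp: numeral_2_eq_2)
  have d2: "(\<lambda>t. partial_deriv j d F (curve z i d' t)) differentiable at 0" if "d \<in> {1, \<i>}" "d' \<in> {1, \<i>}" for d d'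
    using F that ij z by (auto simp: numeral_2_eq_2)
  have w: "wirtinger_bar j (\<lambda>w. complex_of_real (F w)) w =
      (of_real (partial_deriv j 1 F w) + \<i> * of_real (partial_deriv j \<i> F w)) / 2" if "w \<in> U" for w
  proof -
    have "partial_deriv j d (\<lambda>w. complex_of_real (F w)) w = of_real (partial_deriv j d F w)"
      if "d \<in> {1, \<i>}" for d
      by (rule partial_derivI, rule bounded_linear.has_vector_derivative [OF bounded_linear_of_real])
        (rule has_vector_derivative_partial_deriv [OF d1 [OF \<open>w \<in> U\<close> that]])
    then show ?thesis by (simp add: wirtinger_bar_def)
  qed
  have p: "partial_deriv i d (wirtinger_bar j (\<lambda>w. complex_of_real (F w))) z =
      (of_real (partial_deriv i d (partial_deriv j 1 F) z) +
       \<i> * of_real (partial_deriv i d (partial_deriv j \<i> F) z)) / 2" if d: "d \<in> {1, \<i>}" for d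
  proof -
    have h: "((\<lambda>t. complex_of_real (partial_deriv j d' F (curve z i d t))) has_vector_derivative
        of_real (partial_deriv i d (partial_deriv j d' F) z)) (at 0)" if "d' \<in> {1, \<i>}" for d'
      by (rule bounded_linear.has_vector_derivative [OF bounded_linear_of_real])
        (rule has_vector_derivative_partial_deriv [OF d2 [OF that d]])
    have "((\<lambda>t. (1 / 2) * (of_real (partial_deriv j 1 F (curve z i d t)) +
        \<i> * of_real (partial_deriv j \<i> F (curve z i d t)))) has_vector_derivative
      (1 / 2) * (of_real (partial_deriv i d (partial_deriv j 1 F) z) +
       \<i> * of_real (partial_deriv i d (partial_deriv j \<i> F) z))) (at 0)"
      by (intro has_vector_derivative_mult_right has_vector_derivative_add h) auto
    then have "partial_deriv i d (\<lambda>w. (of_real (partial_deriv j 1 F w) +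
        \<i> * of_real (partial_deriv j \<i> F w)) / 2) z =
      (of_real (partial_deriv i d (partial_deriv j 1 F) z) +
       \<i> * of_real (partial_deriv i d (partial_deriv j \<i> F) z)) / 2"
      by (intro partial_derivI) simp
    then show ?thesis
      using partial_deriv_cong [OF U z ij(1) w] by simp
  qed
  have "complex_hessian N F z $$ (i, j) = wirtinger i (wirtinger_bar j (\<lambda>w. of_real (F w))) z"
    using ij by (simp add: complex_hessian_def)
  also have "\<dots> = (partial_deriv i 1 (wirtinger_bar j (\<lambda>w. of_real (F w))) z
      - \<i> * partial_deriv i \<i> (wirtinger_bar j (\<lambda>w. of_real (F w))) z) / 2"
    by (simp add: wirtinger_def)
  also have "\<dots> = of_real ((partial_deriv i 1 (partial_deriv j 1 F) z + partial_deriv i \<i> (partial_deriv j \<i> F) z) / 4) +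
    \<i> * of_real ((partial_deriv i 1 (partial_deriv j \<i> F) z - partial_deriv i \<i> (partial_deriv j 1 F) z) / 4)"
    by (simp add: p complex_eq_iff)
  finally show ?thesis .
qed

text \<open>The holomorphic part contributes the real part of
  \<open>d * d' * cderiv i (cderiv j G) z\<close> to the second derivatives. It cancels in the
  Hessian: the pairs \<open>(1, 1)\<close> and \<open>(\<i>, \<i>)\<close> enter with equal sign but
  opposite value, the two mixed pairs with opposite sign but equal value.\<close>

lemma complex_hessian_Re_cdist:
  assumes U: "open_in_cspace N U" and G: "holomorphic_in N U G" and z: "z \<in> U"
  shows "complex_hessian N (\<lambda>z. Re (G z) + c * (cdist N z p)\<^sup>2) z =
    Matrix.mat N N (\<lambda>(i, j). if i = j then of_real c else 0)"
proof (rule eq_matI)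
  let ?F = "\<lambda>z. Re (G z) + c * (cdist N z p)\<^sup>2"
  fix i j assume "i < dim_row (Matrix.mat N N (\<lambda>(i, j). if i = j then complex_of_real c else 0))"
    "j < dim_col (Matrix.mat N N (\<lambda>(i, j). if i = j then complex_of_real c else 0))"
  then have i: "i < N" and j: "j < N" by auto
  have p1: "partial_deriv j d' ?F w = Re (d' * cderiv j G w + 2 * of_real c * cnj d' * (w j - p j))"
    if "w \<in> U" for w d'
    by (rule partial_derivI [OF has_vector_derivative_curve_Re_cdist [OF G that j]])
  have p2: "partial_deriv i d (partial_deriv j d' ?F) z =
      Re (d * (d' * cderiv i (cderiv j G) z + (if i = j then 2 * of_real c * cnj d' else 0)))" for d d'
  proof -
    let ?K = "\<lambda>w. d' * cderiv j G w + 2 * of_real c * cnj d' * (w j - p j)"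
    have hc: "holomorphic_in N U (cderiv j G)"
      by (rule holomorphic_in_cderiv [OF G U j])
    then have K: "holomorphic_in N U ?K"
      by (intro holomorphic_in_intros)
    have hd: "((\<lambda>w. cderiv j G (z(i := w))) has_field_derivative cderiv i (cderiv j G) z) (at (z i))"
      using hc z i unfolding holomorphic_in_def cderiv_def [of i] by (metis field_differentiable_derivI)
    have "cderiv i ?K z = d' * cderiv i (cderiv j G) z + (if i = j then 2 * of_real c * cnj d' else 0)"
      unfolding cderiv_def [of i ?K]
      by (rule DERIV_imp_deriv, rule DERIV_add [OF DERIV_cmult [OF hd]])
        (cases "i = j"; auto intro!: derivative_eq_intros)
    moreover have "partial_deriv i d (partial_deriv j d' ?F) z = partial_deriv i d (\<lambda>w. Re (?K w)) z"
      by (rule partial_deriv_cong [OF U z i p1])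
    moreover have "partial_deriv i d (\<lambda>w. Re (?K w)) z = Re (d * cderiv i ?K z)"
      by (rule partial_derivI [OF has_vector_derivative_curve_Re [OF K z i]])
    ultimately show ?thesis by simp
  qed
  have C2: "C_k 2 N U ?F"
    using C_infinity_Re_cdist [OF U G] unfolding C_infinity_def by blast
  have "complex_hessian N ?F z $$ (i, j) = (if i = j then of_real c else 0)"
    unfolding complex_hessian_entry [OF U C2 z i j] p2 by (simp add: complex_eq_iff)
  then show "complex_hessian N ?F z $$ (i, j) =
      Matrix.mat N N (\<lambda>(i, j). if i = j then complex_of_real c else 0) $$ (i, j)"
    using i j by simp
qed (auto simp: complex_hessian_def)

lemma num_pos_eigenvalues_scalar:
  assumes "0 < c"
  shows "num_pos_eigenvalues (Matrix.mat N N (\<lambda>(i, j). if i = j then of_real c else 0)) = N"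
\<comment> \<open>For \<open>N = 0\<close> there are no eigenvectors and the set of eigenvalues is
  empty; otherwise it is \<open>{c}\<close>.\<close>
proof (cases "N = 0")
  case True
  let ?H = "Matrix.mat N N (\<lambda>(i, j). if i = j then complex_of_real c else 0)"
  have "\<not> eigenvalue ?H e" for e
    using True by (auto simp: eigenvalue_def eigenvector_def)
  then show ?thesis using True by (simp add: num_pos_eigenvalues_def)
next
  case False
  let ?H = "Matrix.mat N N (\<lambda>(i, j). if i = j then complex_of_real c else 0)"
  have H: "?H \<in> carrier_mat N N" by simp
  have "char_poly ?H = (\<Prod>a\<leftarrow>diag_mat ?H. [:- a, 1:])"
    by (rule char_poly_upper_triangular [OF H]) (auto simp: upper_triangular_def)
  moreover have "diag_mat ?H = replicate N (of_real c)"
    by (rule nth_equalityI) (auto simp: diag_mat_def)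
  ultimately have cp: "char_poly ?H = [:- of_real c, 1:] ^ N"
    by (simp add: prod_list_replicate)
  have "eigenvalue ?H e \<longleftrightarrow> e = of_real c" for e
    using False by (simp add: eigenvalue_root_char_poly [OF H] cp)
  then have "{e::real. 0 < e \<and> eigenvalue ?H (of_real e)} = {c}"
    using assms by auto
  then show ?thesis
    by (simp add: num_pos_eigenvalues_def cp order_power_n_n)
qed

section \<open>Second order Taylor expansion\<close>

lemma uniform_radius:
  fixes g :: "'b \<Rightarrow> real" and N :: nat
  assumes "\<And>j d. j < N \<Longrightarrow> d \<in> {1, \<i>} \<Longrightarrow> \<exists>e>0. \<forall>z\<in>T. g z < e \<longrightarrow> P j d z"
  shows "\<exists>e>0. \<forall>j<N. \<forall>d\<in>{1, \<i>}. \<forall>z\<in>T. g z < e \<longrightarrow> P j d z"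
proof -
  have fin: "\<exists>e>0. \<forall>s\<in>S. \<forall>z\<in>T. g z < e \<longrightarrow> P (fst s) (snd s) z"
    if "finite S" "S \<subseteq> {..<N} \<times> {1, \<i>}" for S
    using that
  proof (induction S)
    case empty
    then show ?case by (intro exI [of _ 1]) auto
  next
    case (insert s S)
    obtain e1 where "e1 > 0" "\<forall>z\<in>T. g z < e1 \<longrightarrow> P (fst s) (snd s) z"
      using assms [of "fst s" "snd s"] insert.prems by auto
    moreover obtain e2 where "e2 > 0" "\<forall>s\<in>S. \<forall>z\<in>T. g z < e2 \<longrightarrow> P (fst s) (snd s) z"
      using insert.IH insert.prems by auto
    ultimately show ?case by (intro exI [of _ "min e1 e2"]) auto
  qed
  have "\<exists>e>0. \<forall>s\<in>{..<N} \<times> {1, \<i>}. \<forall>z\<in>T. g z < e \<longrightarrow> P (fst s) (snd s) z"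
    by (intro fin finite_cartesian_product) auto
  then obtain e where "0 < e"
    "\<forall>s\<in>{..<N} \<times> {1, \<i>}. \<forall>z\<in>T. g z < e \<longrightarrow> P (fst s) (snd s) z" by blast
  then show ?thesis by (intro exI [of _ e]) auto
qed

text \<open>The real differential of \<open>F\<close> at \<open>z\<close> applied to
  \<open>v\<close>, given by its coordinate formula so that it makes sense before total
  differentiability is known.\<close>

definition dir_deriv :: "nat \<Rightarrow> (nat \<Rightarrow> complex) \<Rightarrow> ((nat \<Rightarrow> complex) \<Rightarrow> real) \<Rightarrow> (nat \<Rightarrow> complex) \<Rightarrow> real" where
  "dir_deriv N v F z =
    (\<Sum>j<N. partial_deriv j 1 F z * Re (v j) + partial_deriv j \<i> F z * Im (v j))"

text \<open>\<open>C_k\<close> speaks of derivatives at parameter \<open>0\<close> only; a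
  derivative at \<open>t\<close> is one at \<open>0\<close> of the curve restarted at its point of
  parameter \<open>t\<close>.\<close>

lemma DERIV_curve:
  assumes "(\<lambda>s. F (curve (curve w j d t) j d s)) differentiable at 0"
  shows "((\<lambda>t. F (curve w j d t)) has_real_derivative partial_deriv j d F (curve w j d t)) (at t)"
proof -
  have "((\<lambda>s. F (curve (curve w j d t) j d s)) has_real_derivative partial_deriv j d F (curve w j d t)) (at 0)"
    using has_vector_derivative_partial_deriv [OF assms]
    by (simp add: has_real_derivative_iff_has_vector_derivative)
  then have "((\<lambda>s. F (curve w j d (s + t))) has_real_derivative partial_deriv j d F (curve w j d t)) (at 0)"
    by (simp add: curve_curve add.commute)
  then show ?thesis
    using DERIV_shift [of "\<lambda>s. F (curve w j d s)" _ 0 t] by simp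
qed

text \<open>Mean value inequality for \<open>F - D * t\<close> on the segment. Keeping
  \<open>D\<close> arbitrary allows the derivative at another base point to be inserted.\<close>

lemma curve_increment_bound:
  assumes diff: "\<And>t. t \<in> closed_segment 0 s \<Longrightarrow> (\<lambda>r. F (curve (curve w j d t) j d r)) differentiable at 0"
    and bound: "\<And>t. t \<in> closed_segment 0 s \<Longrightarrow> \<bar>partial_deriv j d F (curve w j d t) - D\<bar> \<le> (\<eta>::real)"
  shows "\<bar>F (curve w j d s) - F w - D * s\<bar> \<le> \<eta> * \<bar>s\<bar>"
proof -
  have "norm ((F (curve w j d s) - D * s) - (F (curve w j d 0) - D * 0)) \<le> \<eta> * norm (s - 0)"
  proof (rule field_differentiable_bound [OF convex_closed_segment])
    show "((\<lambda>t. F (curve w j d t) - D * t) has_real_derivative partial_deriv j d F (curve w j d t) - D)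
        (at t within closed_segment 0 s)" if "t \<in> closed_segment 0 s" for t
      using DERIV_diff [OF DERIV_curve [OF diff [OF that]] DERIV_cmult_Id [of D]]
      by (rule has_field_derivative_at_within)
    show "norm (partial_deriv j d F (curve w j d t) - D) \<le> \<eta>" if "t \<in> closed_segment 0 s" for t
      using bound [OF that] by simp
  qed auto
  then show ?thesis by simp
qed

text \<open>Total differentiability of a \<open>C\<^sup>1\<close> function: go from \<open>p\<close> to \<open>z\<close> parallel to the real axes.\<close>

lemma first_order_expansion:
  fixes F :: "(nat \<Rightarrow> complex) \<Rightarrow> real"
  assumes U: "open_in_cspace N U" and F: "C_k 1 N U F" and p: "p \<in> U" and "0 < \<eta>"
  obtains \<delta> where "0 < \<delta>" "\<And>z. z \<in> cspace N \<Longrightarrow> cdist N z p < \<delta> \<Longrightarrow>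
    \<bar>F z - F p - dir_deriv N (\<lambda>i. z i - p i) F p\<bar> \<le> \<eta> * cdist N z p"
proof -
  \<comment> \<open>There are \<open>2 * N\<close> axis-parallel steps, each with error at most
    \<open>\<epsilon>\<close> times the distance; the added \<open>1\<close> covers
    \<open>N = 0\<close>.\<close>
  define \<epsilon> where "\<epsilon> = \<eta> / (2 * real N + 1)"
  have \<epsilon>: "0 < \<epsilon>" "2 * real N * \<epsilon> \<le> \<eta>"
    using \<open>0 < \<eta>\<close> by (auto simp: \<epsilon>_def field_simps)
  have rad: "\<exists>e>0. \<forall>z\<in>cspace N. cdist N z p < e \<longrightarrow> z \<in> U \<and>
      \<bar>partial_deriv j d F z - partial_deriv j d F p\<bar> < \<epsilon>" if "j < N" "d \<in> {1, \<i>}" for j d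
  proof -
    have "continuous_on U (partial_deriv j d F)" using F that by auto
    then obtain e1 where "e1 > 0"
      "\<forall>z\<in>U. cdist N z p < e1 \<longrightarrow> \<bar>partial_deriv j d F z - partial_deriv j d F p\<bar> < \<epsilon>"
      unfolding continuous_on_cspace_iff [OF open_in_cspace_subset [OF U]] dist_real_def
      using p \<epsilon>(1) by blast
    moreover obtain e2 where "0 < e2" "\<And>z. z \<in> cspace N \<Longrightarrow> cdist N z p < e2 \<Longrightarrow> z \<in> U"
      using open_in_cspaceE [OF U p] by blast
    ultimately show ?thesis by (intro exI [of _ "min e1 e2"]) auto
  qed
  have "\<exists>e>0. \<forall>j<N. \<forall>d\<in>{1, \<i>}. \<forall>z\<in>cspace N. cdist N z p < e \<longrightarrow>
      z \<in> U \<and> \<bar>partial_deriv j d F z - partial_deriv j d F p\<bar> < \<epsilon>"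
    by (rule uniform_radius) (rule rad)
  then obtain \<delta> where \<delta>: "0 < \<delta>" "\<And>j d z. j < N \<Longrightarrow> d \<in> {1, \<i>} \<Longrightarrow> z \<in> cspace N \<Longrightarrow> cdist N z p < \<delta> \<Longrightarrow>
      z \<in> U \<and> \<bar>partial_deriv j d F z - partial_deriv j d F p\<bar> < \<epsilon>"
    by blast
  show thesis
  proof (rule that [OF \<delta>(1)])
    fix z assume z: "z \<in> cspace N" "cdist N z p < \<delta>"
    have pc: "p \<in> cspace N" using p open_in_cspace_subset [OF U] by blast
    define v where "v = (\<lambda>i. z i - p i)"
    \<comment> \<open>\<open>P k\<close> has taken its first \<open>k\<close> coordinates from
      \<open>z\<close>; \<open>Q k\<close> lies between \<open>P k\<close> and
      \<open>P (Suc k)\<close>, with the real part of coordinate \<open>k\<close> adjusted as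
      well.\<close>
    define P where "P = (\<lambda>k i. if i < k then z i else p i)"
    define Q where "Q = (\<lambda>k. curve (P k) k 1 (Re (v k)))"
    have PN: "P k \<in> cspace N" "Q k \<in> cspace N" if "k < N" for k
      using z(1) pc that by (auto simp: P_def Q_def cspace_def curve_def)
    \<comment> \<open>Along the whole path no coordinate is farther from \<open>p\<close> than that
      of \<open>z\<close>, so the path stays in the ball where the partial derivatives are close to
      those at \<open>p\<close>.\<close>
    have step: "\<bar>F (curve w k d s) - F w - partial_deriv k d F p * s\<bar> \<le> \<epsilon> * \<bar>s\<bar>"
      if k: "k < N" and d: "d \<in> {1, \<i>}" and w: "w \<in> cspace N"
        and near: "\<And>t i. t \<in> closed_segment 0 s \<Longrightarrow> cmod (curve w k d t i - p i) \<le> cmod (z i - p i)"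
      for k d w s
    proof (rule curve_increment_bound)
      fix t assume t: "t \<in> closed_segment 0 s"
      have "cdist N (curve w k d t) p \<le> cdist N z p"
        by (rule cdist_mono) (rule near [OF t])
      then have *: "curve w k d t \<in> U \<and>
          \<bar>partial_deriv k d F (curve w k d t) - partial_deriv k d F p\<bar> < \<epsilon>"
        using z(2) w k by (intro \<delta>(2) [OF k d]) auto
      then show "(\<lambda>r. F (curve (curve w k d t) k d r)) differentiable at 0"
        using F k d by auto
      show "\<bar>partial_deriv k d F (curve w k d t) - partial_deriv k d F p\<bar> \<le> \<epsilon>"
        using * by simp
    qed
    have seg: "\<bar>t\<bar> \<le> \<bar>s\<bar>" if "t \<in> closed_segment 0 s" for t s :: real
      using that by (auto simp: closed_segment_eq_real_ivl split: if_splits)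
    have incr: "\<bar>F (P (Suc k)) - F (P k) -
        (partial_deriv k 1 F p * Re (v k) + partial_deriv k \<i> F p * Im (v k))\<bar> \<le> 2 * \<epsilon> * cdist N z p"
      if k: "k < N" for k
    proof -
      have "\<bar>F (Q k) - F (P k) - partial_deriv k 1 F p * Re (v k)\<bar> \<le> \<epsilon> * \<bar>Re (v k)\<bar>"
        unfolding Q_def
      proof (rule step [OF k _ PN(1) [OF k]])
        fix t i assume t: "t \<in> closed_segment 0 (Re (v k))"
        then have "\<bar>t\<bar> \<le> cmod (v k)"
          using seg [OF t] abs_Re_le_cmod [of "v k"] by linarith
        then show "cmod (curve (P k) k 1 t i - p i) \<le> cmod (z i - p i)"
          by (auto simp: P_def curve_def v_def)
      qed auto
      moreover have "\<bar>F (curve (Q k) k \<i> (Im (v k))) - F (Q k) - partial_deriv k \<i> F p * Im (v k)\<bar> \<le> \<epsilon> * \<bar>Im (v k)\<bar>"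
      proof (rule step [OF k _ PN(2) [OF k]])
        fix t i assume t: "t \<in> closed_segment 0 (Im (v k))"
        have "cmod (of_real (Re (v k)) + of_real t * \<i>) \<le> cmod (v k)"
          unfolding cmod_def
          by (rule real_sqrt_le_mono) (use seg [OF t] in \<open>auto simp: abs_le_square_iff\<close>)
        then show "cmod (curve (Q k) k \<i> t i - p i) \<le> cmod (z i - p i)"
          by (auto simp: P_def Q_def curve_def v_def algebra_simps)
      qed auto
      moreover have "curve (Q k) k \<i> (Im (v k)) = P (Suc k)"
        by (auto simp: fun_eq_iff Q_def P_def curve_def v_def complex_eq_iff less_Suc_eq)
      moreover have "\<epsilon> * \<bar>Re (v k)\<bar> \<le> \<epsilon> * cdist N z p" "\<epsilon> * \<bar>Im (v k)\<bar> \<le> \<epsilon> * cdist N z p"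
        using \<epsilon>(1) coord_le_cdist [OF k, of z p] abs_Re_le_cmod [of "v k"] abs_Im_le_cmod [of "v k"]
        by (auto simp: v_def intro!: mult_left_mono)
      ultimately show ?thesis by simp
    qed
    have ends: "P 0 = p" "P N = z"
      using z(1) pc by (auto simp: P_def fun_eq_iff cspace_def)
    have tel: "(\<Sum>k<N. F (P (Suc k)) - F (P k)) = F z - F p"
      using sum_lessThan_telescope [of "\<lambda>k. F (P k)" N] ends by simp
    have "F z - F p - dir_deriv N v F p = (\<Sum>k<N. F (P (Suc k)) - F (P k) -
        (partial_deriv k 1 F p * Re (v k) + partial_deriv k \<i> F p * Im (v k)))"
      unfolding sum_subtractf [of "\<lambda>k. F (P (Suc k)) - F (P k)"] tel dir_deriv_def ..
    also have "\<bar>\<dots>\<bar> \<le> (\<Sum>k<N. 2 * \<epsilon> * cdist N z p)"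
      by (rule order_trans [OF sum_abs sum_mono]) (use incr in auto)
    also have "\<dots> = (2 * real N * \<epsilon>) * cdist N z p" by simp
    also have "\<dots> \<le> \<eta> * cdist N z p"
      by (rule mult_right_mono [OF \<epsilon>(2)]) simp
    finally show "\<bar>F z - F p - dir_deriv N (\<lambda>i. z i - p i) F p\<bar> \<le> \<eta> * cdist N z p"
      unfolding v_def .
  qed
qed

text \<open>The quadratic form of the real Hessian, written with the differentials of the first
  partial derivatives so that \<open>first_order_expansion\<close> applies to each of them.\<close>

definition second_dir_deriv :: "nat \<Rightarrow> (nat \<Rightarrow> complex) \<Rightarrow> ((nat \<Rightarrow> complex) \<Rightarrow> real) \<Rightarrow> (nat \<Rightarrow> complex) \<Rightarrow> real" where
  "second_dir_deriv N v F z =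
    (\<Sum>j<N. dir_deriv N v (partial_deriv j 1 F) z * Re (v j) + dir_deriv N v (partial_deriv j \<i> F) z * Im (v j))"

lemma dir_deriv_scale: "dir_deriv N (\<lambda>i. of_real t * v i) F z = t * dir_deriv N v F z"
  by (simp add: dir_deriv_def sum_distrib_left algebra_simps)

lemma cdist_line:
  "cdist N (\<lambda>i. p i + of_real t * v i) (\<lambda>i. p i + of_real s * v i) = \<bar>t - s\<bar> * cdist N v (\<lambda>_. 0)"
proof -
  have "cmod ((p i + of_real t * v i) - (p i + of_real s * v i)) = \<bar>t - s\<bar> * cmod (v i - 0)" for i
  proof -
    have "(p i + of_real t * v i) - (p i + of_real s * v i) = of_real (t - s) * v i"
      by (simp add: algebra_simps)
    then show ?thesis by (simp only: norm_mult norm_of_real diff_0_right)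
  qed
  then show ?thesis
    by (simp add: cdist_def L2_set_right_distrib)
qed

text \<open>Chain rule along a straight line, read off from \<open>first_order_expansion\<close> at
  the point of parameter \<open>t\<close>; \<open>C_k\<close> itself only provides derivatives
  parallel to the axes.\<close>

lemma DERIV_line:
  fixes F :: "(nat \<Rightarrow> complex) \<Rightarrow> real"
  assumes U: "open_in_cspace N U" and F: "C_k 1 N U F" and v: "v \<in> cspace N"
    and t: "(\<lambda>i. p i + of_real t * v i) \<in> U"
  shows "((\<lambda>t. F (\<lambda>i. p i + of_real t * v i)) has_real_derivative
    dir_deriv N v F (\<lambda>i. p i + of_real t * v i)) (at t)"
proof -
  define \<gamma> where "\<gamma> = (\<lambda>t i. p i + complex_of_real t * v i)"
  define c where "c = cdist N v (\<lambda>_. 0)"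
  have c: "0 \<le> c" by (simp add: c_def)
  have \<gamma>U: "\<gamma> t \<in> U" using t by (simp add: \<gamma>_def)
  have \<gamma>c: "\<gamma> s \<in> cspace N" for s
  proof -
    have "p i + complex_of_real t * v i = 0" if "N \<le> i" for i
      using t open_in_cspace_subset [OF U] that by (auto simp: cspace_def)
    then show ?thesis using v by (simp add: \<gamma>_def cspace_def)
  qed
  have "((\<lambda>t. F (\<gamma> t)) has_derivative ((*) (dir_deriv N v F (\<gamma> t)))) (at t)"
    unfolding has_derivative_at_alt
  proof (intro conjI allI impI)
    show "bounded_linear ((*) (dir_deriv N v F (\<gamma> t)))" by (rule bounded_linear_mult_right)
    fix e :: real assume "0 < e"
    \<comment> \<open>The denominator is \<open>c + 1\<close> because \<open>v\<close>, and with it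
      \<open>c\<close>, may vanish.\<close>
    then obtain \<delta> where \<delta>: "0 < \<delta>" "\<And>z. z \<in> cspace N \<Longrightarrow> cdist N z (\<gamma> t) < \<delta> \<Longrightarrow>
        \<bar>F z - F (\<gamma> t) - dir_deriv N (\<lambda>i. z i - \<gamma> t i) F (\<gamma> t)\<bar> \<le> e / (c + 1) * cdist N z (\<gamma> t)"
      using first_order_expansion [OF U F \<gamma>U, of "e / (c + 1)"] c by auto
    show "\<exists>d>0. \<forall>s. norm (s - t) < d \<longrightarrow>
        norm (F (\<gamma> s) - F (\<gamma> t) - dir_deriv N v F (\<gamma> t) * (s - t)) \<le> e * norm (s - t)"
    proof (intro exI [of _ "\<delta> / (c + 1)"] conjI allI impI)
      show "0 < \<delta> / (c + 1)" using \<delta>(1) c by simp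
      fix s assume s: "norm (s - t) < \<delta> / (c + 1)"
      have cd: "cdist N (\<gamma> s) (\<gamma> t) = \<bar>s - t\<bar> * c"
        unfolding \<gamma>_def c_def by (rule cdist_line)
      have "\<bar>s - t\<bar> * c \<le> \<bar>s - t\<bar> * (c + 1)" by (rule mult_left_mono) auto
      also have "\<dots> < \<delta>" using s c by (simp add: field_simps)
      finally have "\<bar>F (\<gamma> s) - F (\<gamma> t) - dir_deriv N (\<lambda>i. \<gamma> s i - \<gamma> t i) F (\<gamma> t)\<bar> \<le> e / (c + 1) * (\<bar>s - t\<bar> * c)"
        using \<delta>(2) [OF \<gamma>c, of s] cd by simp
      moreover have "dir_deriv N (\<lambda>i. \<gamma> s i - \<gamma> t i) F (\<gamma> t) = dir_deriv N v F (\<gamma> t) * (s - t)"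
      proof -
        have "(\<lambda>i. \<gamma> s i - \<gamma> t i) = (\<lambda>i. of_real (s - t) * v i)"
          by (simp add: \<gamma>_def algebra_simps fun_eq_iff)
        then show ?thesis by (simp only: dir_deriv_scale) (rule mult.commute)
      qed
      moreover have "e / (c + 1) * (\<bar>s - t\<bar> * c) \<le> e * \<bar>s - t\<bar>"
      proof -
        have "c / (c + 1) \<le> 1" using c by simp
        then have "(e * \<bar>s - t\<bar>) * (c / (c + 1)) \<le> (e * \<bar>s - t\<bar>) * 1"
          using \<open>0 < e\<close> by (intro mult_left_mono) auto
        then show ?thesis by (simp add: mult_ac)
      qed
      ultimately show "norm (F (\<gamma> s) - F (\<gamma> t) - dir_deriv N v F (\<gamma> t) * (s - t)) \<le> e * norm (s - t)"
        by (simp only: real_norm_def)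
    qed
  qed
  then show ?thesis
    unfolding has_field_derivative_def \<gamma>_def .
qed

text \<open>The first order expansion of each first partial derivative shows that the derivative of
  \<open>F\<close> along the segment from \<open>p\<close> to \<open>z\<close> is
  \<open>L + t * M\<close> up to \<open>\<eta> * r\<^sup>2\<close>. The mean value inequality,
  applied along the segment to \<open>F\<close> minus \<open>L * t + M * (t ^ 2 / 2)\<close>, then
  gives the claim.\<close>

lemma second_order_expansion:
  fixes F :: "(nat \<Rightarrow> complex) \<Rightarrow> real"
  assumes U: "open_in_cspace N U" and F: "C_k 2 N U F" and p: "p \<in> U" and "0 < \<eta>"
  obtains \<delta> where "0 < \<delta>" "\<And>z. z \<in> cspace N \<Longrightarrow> cdist N z p < \<delta> \<Longrightarrow> z \<in> U \<and>
    \<bar>F z - F p - dir_deriv N (\<lambda>i. z i - p i) F p - second_dir_deriv N (\<lambda>i. z i - p i) F p / 2\<bar>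
      \<le> \<eta> * (cdist N z p)\<^sup>2"
proof -
  define \<epsilon> where "\<epsilon> = \<eta> / (2 * real N + 1)"
  have \<epsilon>: "0 < \<epsilon>" "2 * real N * \<epsilon> \<le> \<eta>"
    using \<open>0 < \<eta>\<close> by (auto simp: \<epsilon>_def field_simps)
  have F1: "C_k 1 N U F" using F by (auto simp: numeral_2_eq_2)
  have rad: "\<exists>e>0. \<forall>z\<in>cspace N. cdist N z p < e \<longrightarrow>
      \<bar>partial_deriv j d F z - partial_deriv j d F p - dir_deriv N (\<lambda>i. z i - p i) (partial_deriv j d F) p\<bar>
        \<le> \<epsilon> * cdist N z p" if "j < N" "d \<in> {1, \<i>}" for j d
  proof -
    have "C_k 1 N U (partial_deriv j d F)" using F that by (auto simp: numeral_2_eq_2)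
    from first_order_expansion [OF U this p \<epsilon>(1)] show ?thesis by metis
  qed
  have "\<exists>e>0. \<forall>j<N. \<forall>d\<in>{1, \<i>}. \<forall>z\<in>cspace N. cdist N z p < e \<longrightarrow>
      \<bar>partial_deriv j d F z - partial_deriv j d F p - dir_deriv N (\<lambda>i. z i - p i) (partial_deriv j d F) p\<bar>
        \<le> \<epsilon> * cdist N z p"
    by (rule uniform_radius) (rule rad)
  then obtain e where e: "e > 0" "\<And>j d z. j < N \<Longrightarrow> d \<in> {1, \<i>} \<Longrightarrow> z \<in> cspace N \<Longrightarrow> cdist N z p < e \<Longrightarrow>
      \<bar>partial_deriv j d F z - partial_deriv j d F p - dir_deriv N (\<lambda>i. z i - p i) (partial_deriv j d F) p\<bar>
        \<le> \<epsilon> * cdist N z p"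
    by blast
  obtain e0 where e0: "0 < e0" "\<And>z. z \<in> cspace N \<Longrightarrow> cdist N z p < e0 \<Longrightarrow> z \<in> U"
    using open_in_cspaceE [OF U p] by blast
  define \<delta> where "\<delta> = min e0 e"
  have \<delta>: "0 < \<delta>" "\<delta> \<le> e0" "\<delta> \<le> e"
    using e(1) e0(1) by (auto simp: \<delta>_def)
  have pc: "p \<in> cspace N" using p open_in_cspace_subset [OF U] by blast
  show thesis
  proof (rule that [OF \<delta>(1)])
    fix z assume z: "z \<in> cspace N" "cdist N z p < \<delta>"
    define v where "v = (\<lambda>i. z i - p i)"
    define r where "r = cdist N z p"
    define \<gamma> where "\<gamma> = (\<lambda>t i. p i + complex_of_real t * v i)"
    define L where "L = dir_deriv N v F p"
    define M where "M = second_dir_deriv N v F p"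
    have v: "v \<in> cspace N" using z pc by (simp add: v_def cspace_def)
    have \<gamma>c: "\<gamma> t \<in> cspace N" for t using v pc by (simp add: \<gamma>_def cspace_def)
    have \<gamma>01: "\<gamma> 0 = p" "\<gamma> 1 = z" by (simp_all add: \<gamma>_def v_def fun_eq_iff)
    have cv: "cdist N v (\<lambda>_. 0) = r" by (simp add: v_def r_def cdist_def)
    have cd: "cdist N (\<gamma> t) p = \<bar>t\<bar> * r" for t
      using cdist_line [of N p t v 0] by (simp add: \<gamma>_def cv)
    have cd01: "cdist N (\<gamma> t) p < \<delta>" if "t \<in> {0..1}" for t
    proof -
      have "\<bar>t\<bar> * r \<le> 1 * r" using that by (intro mult_right_mono) (auto simp: r_def)
      then show ?thesis using z(2) cd by (simp add: r_def)
    qed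
    have \<gamma>U: "\<gamma> t \<in> U" if "t \<in> {0..1}" for t
      using cd01 [OF that] \<delta>(2) \<gamma>c by (intro e0(2)) auto
    have rem: "\<bar>dir_deriv N v F (\<gamma> t) - L - t * M\<bar> \<le> \<eta> * r\<^sup>2" if t: "t \<in> {0..1}" for t
    proof -
      define R where "R = (\<lambda>j d. partial_deriv j d F (\<gamma> t) - partial_deriv j d F p - t * dir_deriv N v (partial_deriv j d F) p)"
      have R: "\<bar>R j d\<bar> \<le> \<epsilon> * r" if "j < N" "d \<in> {1, \<i>}" for j d
      proof -
        have "(\<lambda>i. \<gamma> t i - p i) = (\<lambda>i. of_real t * v i)" by (simp add: \<gamma>_def)
        then have "\<bar>R j d\<bar> \<le> \<epsilon> * cdist N (\<gamma> t) p"
          using e(2) [OF that \<gamma>c, of t] cd01 [OF t] \<delta>(3)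
          by (simp add: R_def dir_deriv_scale)
        also have "\<dots> \<le> \<epsilon> * r"
          using t \<epsilon>(1) by (auto simp: cd r_def intro!: mult_left_mono mult_left_le_one_le)
        finally show ?thesis .
      qed
      have "dir_deriv N v F (\<gamma> t) - L - t * M = (\<Sum>j<N. R j 1 * Re (v j) + R j \<i> * Im (v j))"
        by (simp add: L_def M_def R_def second_dir_deriv_def dir_deriv_def [of N v F]
            sum_distrib_left sum_subtractf [symmetric] algebra_simps)
      also have "\<bar>\<dots>\<bar> \<le> (\<Sum>j<N. 2 * \<epsilon> * r\<^sup>2)"
      proof (rule order_trans [OF sum_abs sum_mono])
        fix j assume "j \<in> {..<N}"
        then have j: "j < N" by simp
        have "\<bar>Re (v j)\<bar> \<le> r" "\<bar>Im (v j)\<bar> \<le> r"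
          using coord_le_cdist [OF j, of z p] abs_Re_le_cmod [of "v j"] abs_Im_le_cmod [of "v j"]
          by (auto simp: v_def r_def)
        then have "\<bar>R j 1 * Re (v j)\<bar> \<le> (\<epsilon> * r) * r" "\<bar>R j \<i> * Im (v j)\<bar> \<le> (\<epsilon> * r) * r"
          unfolding abs_mult using R [OF j] by (auto intro!: mult_mono simp: r_def \<epsilon>(1) less_imp_le)
        then show "\<bar>R j 1 * Re (v j) + R j \<i> * Im (v j)\<bar> \<le> 2 * \<epsilon> * r\<^sup>2"
          by (simp add: power2_eq_square)
      qed
      also have "\<dots> = (2 * real N * \<epsilon>) * r\<^sup>2" by simp
      also have "\<dots> \<le> \<eta> * r\<^sup>2" by (rule mult_right_mono [OF \<epsilon>(2)]) simp
      finally show ?thesis .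
    qed
    have "norm ((F (\<gamma> 1) - L * 1 - M * (1 ^ 2 / 2)) - (F (\<gamma> 0) - L * 0 - M * (0 ^ 2 / 2))) \<le> \<eta> * r\<^sup>2 * norm (1 - 0 :: real)"
    proof (rule field_differentiable_bound [where S = "{0..1::real}"])
      show "((\<lambda>t. F (\<gamma> t) - L * t - M * (t ^ 2 / 2)) has_real_derivative dir_deriv N v F (\<gamma> t) - L - t * M)
          (at t within {0..1})" if "t \<in> {0..1}" for t
      proof (rule has_field_derivative_at_within)
        have "((\<lambda>t. F (\<gamma> t)) has_real_derivative dir_deriv N v F (\<gamma> t)) (at t)"
          unfolding \<gamma>_def by (rule DERIV_line [OF U F1 v]) (use \<gamma>U [OF that] in \<open>simp add: \<gamma>_def\<close>)
        then show "((\<lambda>t. F (\<gamma> t) - L * t - M * (t ^ 2 / 2)) has_real_derivative dir_deriv N v F (\<gamma> t) - L - t * M) (at t)"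
          by (auto intro!: derivative_eq_intros)
      qed
      show "norm (dir_deriv N v F (\<gamma> t) - L - t * M) \<le> \<eta> * r\<^sup>2" if "t \<in> {0..1}" for t
        using rem [OF that] by simp
    qed auto
    then have "\<bar>F z - F p - L - M / 2\<bar> \<le> \<eta> * r\<^sup>2"
      by (simp add: \<gamma>01 algebra_simps)
    then show "z \<in> U \<and> \<bar>F z - F p - dir_deriv N (\<lambda>i. z i - p i) F p - second_dir_deriv N (\<lambda>i. z i - p i) F p / 2\<bar>
      \<le> \<eta> * (cdist N z p)\<^sup>2"
      using \<gamma>U [of 1] by (simp add: L_def M_def r_def v_def \<gamma>01)
  qed
qed

section \<open>Local models\<close>

lemma hermitian_form_lower_bound:
  fixes h :: "nat \<Rightarrow> nat \<Rightarrow> complex"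
  assumes pos: "\<And>v. v \<in> cspace N \<Longrightarrow> v \<noteq> (\<lambda>_. 0) \<Longrightarrow> 0 < Re (\<Sum>i<N. \<Sum>j<N. h i j * v i * cnj (v j))"
  shows "\<exists>\<epsilon>>0. \<forall>v\<in>cspace N. \<epsilon> * (cdist N v (\<lambda>_. 0))\<^sup>2 \<le> Re (\<Sum>i<N. \<Sum>j<N. h i j * v i * cnj (v j))"
proof -
  define L where "L = (\<lambda>v. Re (\<Sum>i<N. \<Sum>j<N. h i j * v i * cnj (v j)))"
  \<comment> \<open>The form is minimised over the compact unit sphere \<open>S\<close>; homogeneity
    of degree two carries the bound to all vectors.\<close>
  define S where "S = {v \<in> cspace N. cdist N v (\<lambda>_. 0) \<le> 1} \<inter> {v. cdist N v (\<lambda>_. 0) = 1}"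
  have cS: "compact S"
    unfolding S_def
    by (intro compact_Int_closed compact_cspace_cball closed_Collect_eq)
      (auto intro: continuous_on_cdist)
  have cL: "continuous_on S L"
    unfolding L_def
    by (intro continuous_intros continuous_on_subset [OF continuous_on_product_coordinates]) auto
  have "\<exists>\<epsilon>>0. \<forall>v\<in>S. \<epsilon> \<le> L v"
  \<comment> \<open>The sphere is empty exactly when \<open>N = 0\<close>, and then any positive
    constant will do.\<close>
  proof (cases "S = {}")
    case True
    then show ?thesis by (intro exI [of _ 1]) auto
  next
    case False
    obtain v where v: "v \<in> S" "\<And>w. w \<in> S \<Longrightarrow> L v \<le> L w"
      using continuous_attains_inf [OF cS False cL] by blast
    have "v \<noteq> (\<lambda>_. 0)" using v(1) by (auto simp: S_def)
    then have "0 < L v" unfolding L_def using v(1) by (intro pos) (auto simp: S_def)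
    then show ?thesis using v(2) by blast
  qed
  then obtain \<epsilon> where \<epsilon>: "0 < \<epsilon>" "\<And>v. v \<in> S \<Longrightarrow> \<epsilon> \<le> L v" by blast
  have "\<epsilon> * (cdist N v (\<lambda>_. 0))\<^sup>2 \<le> L v" if v: "v \<in> cspace N" for v
  proof (cases "cdist N v (\<lambda>_. 0) = 0")
    case True
    have "v = (\<lambda>_. 0)"
    proof
      fix i show "v i = 0"
        using coord_le_cdist [of i N v "\<lambda>_. 0"] v True by (cases "i < N") (auto simp: cspace_def)
    qed
    then show ?thesis by (simp add: L_def)
  next
    case False
    define c where "c = cdist N v (\<lambda>_. 0)"
    have c: "0 < c" using False cdist_nonneg [of N v "\<lambda>_. 0"] unfolding c_def by linarith
    define u where "u = (\<lambda>i. of_real (1 / c) * v i)"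
    have "cdist N u (\<lambda>_. 0) = 1"
      using cdist_line [of N "\<lambda>_. 0" "1 / c" v 0] c by (simp add: u_def c_def [symmetric])
    then have "u \<in> S" using v by (auto simp: S_def u_def cspace_def)
    moreover have "L v = c\<^sup>2 * L u"
    proof -
      have "v = (\<lambda>i. of_real c * u i)" using c by (simp add: u_def)
      then have "L v = Re (\<Sum>i<N. \<Sum>j<N. of_real (c\<^sup>2) * (h i j * u i * cnj (u j)))"
        unfolding L_def by (simp add: power2_eq_square mult_ac)
      also have "\<dots> = c\<^sup>2 * L u"
        unfolding L_def sum_distrib_left [symmetric] Re_complex_of_real by simp
      finally show ?thesis .
    qed
    ultimately show ?thesis
      using mult_right_mono [OF \<epsilon>(2), of u "c\<^sup>2"] by (simp add: c_def [symmetric] mult.commute)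
  qed
  then show ?thesis using \<epsilon>(1) unfolding L_def by blast
qed

text \<open>Every real bilinear form on the complex plane is the real part of a complex bilinear
  form plus the real part of a sesquilinear one. The coefficient of the second is the Hessian entry
  of \<open>complex_hessian_entry\<close>; that of the first goes into a holomorphic
  polynomial.\<close>

lemma Re_second_order_split:
  fixes A B C D :: real and v w :: complex
  shows "(A * Re v + B * Im v) * Re w + (C * Re v + D * Im v) * Im w =
    2 * (Re (Complex ((A - D) / 4) (- (B + C) / 4) * v * w) +
         Re ((of_real ((A + D) / 4) + \<i> * of_real ((C - B) / 4)) * v * cnj w))"
  by (simp add: field_simps)

text \<open>The quadratic Taylor polynomial of \<open>F\<close> is the real part of a holomorphic polynomial plus the
  Levi form.\<close>

lemma strictly_psh_holomorphic_minorant: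
  assumes U: "open_in_cspace N U" and F: "C2_strictly_psh N U F" and p: "p \<in> U"
  obtains Q \<epsilon> \<delta> where "\<And>V. holomorphic_in N V Q" "Q p = 0" "0 < \<epsilon>" "0 < \<delta>"
    "\<And>z. z \<in> cspace N \<Longrightarrow> cdist N z p < \<delta> \<Longrightarrow> F p + Re (Q z) + \<epsilon> * (cdist N z p)\<^sup>2 \<le> F z"
proof -
  have C2: "C_k 2 N U F" using F by (simp add: C2_strictly_psh_def)
  define H where "H = (\<lambda>i j. complex_hessian N F p $$ (i, j))"
  define A where "A = (\<lambda>d d' i j. partial_deriv i d (partial_deriv j d' F) p)"
  define K where "K = (\<lambda>i j. Complex ((A 1 1 i j - A \<i> \<i> i j) / 4) (- (A \<i> 1 i j + A 1 \<i> i j) / 4))"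
  define P where "P = (\<lambda>v. \<Sum>j<N. \<Sum>i<N. K i j * v i * v j)"
  \<comment> \<open>The linear coefficient is twice the Wirtinger derivative, since
    \<open>Re ((a - \<i> * b) * v) = a * Re v + b * Im v\<close> for real \<open>a\<close> and
    \<open>b\<close>.\<close>
  define Q where "Q = (\<lambda>z. (\<Sum>j<N. Complex (partial_deriv j 1 F p) (- partial_deriv j \<i> F p) * (z j - p j)) +
      P (\<lambda>i. z i - p i))"
  obtain \<epsilon> where \<epsilon>: "0 < \<epsilon>"
    "\<And>v. v \<in> cspace N \<Longrightarrow> \<epsilon> * (cdist N v (\<lambda>_. 0))\<^sup>2 \<le> Re (\<Sum>i<N. \<Sum>j<N. H i j * v i * cnj (v j))"
    using hermitian_form_lower_bound [of N H] F p unfolding C2_strictly_psh_def H_def by blast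
  \<comment> \<open>Half of the lower bound of the Levi form pays for the Taylor remainder; the
    other half is the quadratic gain.\<close>
  obtain \<delta> where \<delta>: "0 < \<delta>" "\<And>z. z \<in> cspace N \<Longrightarrow> cdist N z p < \<delta> \<Longrightarrow> z \<in> U \<and>
    \<bar>F z - F p - dir_deriv N (\<lambda>i. z i - p i) F p - second_dir_deriv N (\<lambda>i. z i - p i) F p / 2\<bar>
      \<le> (\<epsilon> / 2) * (cdist N z p)\<^sup>2"
    using second_order_expansion [OF U C2 p, of "\<epsilon> / 2"] \<epsilon>(1) by auto
  have split: "second_dir_deriv N v F p / 2 = Re (P v) + Re (\<Sum>i<N. \<Sum>j<N. H i j * v i * cnj (v j))" for v
  proof -
    have "second_dir_deriv N v F p = (\<Sum>j<N. \<Sum>i<N.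
        (A 1 1 i j * Re (v i) + A \<i> 1 i j * Im (v i)) * Re (v j) +
        (A 1 \<i> i j * Re (v i) + A \<i> \<i> i j * Im (v i)) * Im (v j))"
      by (simp only: second_dir_deriv_def dir_deriv_def A_def sum_distrib_right sum.distrib [symmetric])
    also have "\<dots> = (\<Sum>j<N. \<Sum>i<N. 2 * (Re (K i j * v i * v j) + Re (H i j * v i * cnj (v j))))"
    proof (intro sum.cong refl)
      fix i j assume "j \<in> {..<N}" "i \<in> {..<N}"
      then have "H i j = of_real ((A 1 1 i j + A \<i> \<i> i j) / 4) + \<i> * of_real ((A 1 \<i> i j - A \<i> 1 i j) / 4)"
        unfolding H_def A_def by (intro complex_hessian_entry [OF U C2 p]) auto
      then show "(A 1 1 i j * Re (v i) + A \<i> 1 i j * Im (v i)) * Re (v j) +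
          (A 1 \<i> i j * Re (v i) + A \<i> \<i> i j * Im (v i)) * Im (v j) =
          2 * (Re (K i j * v i * v j) + Re (H i j * v i * cnj (v j)))"
        unfolding K_def by (simp only: Re_second_order_split)
    qed
    also have "\<dots> = 2 * (Re (P v) + Re (\<Sum>j<N. \<Sum>i<N. H i j * v i * cnj (v j)))"
      unfolding P_def Re_sum sum_distrib_left [symmetric] sum.distrib ..
    finally show ?thesis
      by (subst sum.swap) simp
  qed
  show thesis
  proof (rule that [of Q, OF _ _ _ \<delta>(1)])
    show "holomorphic_in N V Q" for V
      unfolding Q_def P_def by (intro holomorphic_in_intros)
    show "Q p = 0" by (simp add: Q_def P_def)
    show "0 < \<epsilon> / 2" using \<epsilon>(1) by simp
    fix z assume z: "z \<in> cspace N" "cdist N z p < \<delta>"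
    define v where "v = (\<lambda>i. z i - p i)"
    have "p \<in> cspace N" using p open_in_cspace_subset [OF U] by blast
    then have v: "v \<in> cspace N" using z(1) by (simp add: v_def cspace_def)
    have cv: "cdist N v (\<lambda>_. 0) = cdist N z p" by (simp add: v_def cdist_def)
    have "Re (Q z) = dir_deriv N v F p + Re (P v)"
      by (simp add: Q_def v_def dir_deriv_def)
    moreover have "\<bar>F z - F p - dir_deriv N v F p - second_dir_deriv N v F p / 2\<bar> \<le> (\<epsilon> / 2) * (cdist N z p)\<^sup>2"
      using \<delta>(2) [OF z] by (simp add: v_def)
    moreover have "\<epsilon> * (cdist N z p)\<^sup>2 \<le> Re (\<Sum>i<N. \<Sum>j<N. H i j * v i * cnj (v j))"
      using \<epsilon>(2) [OF v] by (simp add: cv)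
    moreover have "\<epsilon> * (cdist N z p)\<^sup>2 = 2 * ((\<epsilon> / 2) * (cdist N z p)\<^sup>2)" by simp
    ultimately show "F p + Re (Q z) + \<epsilon> / 2 * (cdist N z p)\<^sup>2 \<le> F z"
      using split [of v] by linarith
  qed
qed

section \<open>Analytic subvarieties and shrinking of local models\<close>

lemma analytic_subvarietyE:
  assumes "analytic_subvariety N U Z" "w \<in> U"
  obtains W \<F> where "open_in_cspace N W" "w \<in> W" "W \<subseteq> U" "finite \<F>"
    "\<forall>F\<in>\<F>. holomorphic_in N W F" "Z \<inter> W = {x \<in> W. \<forall>F\<in>\<F>. F x = 0}"
proof -
  have "\<exists>W \<F>. open_in_cspace N W \<and> w \<in> W \<and> W \<subseteq> U \<and> finite \<F> \<and>
      (\<forall>F\<in>\<F>. holomorphic_in N W F) \<and> Z \<inter> W = {x \<in> W. \<forall>F\<in>\<F>. F x = 0}"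
    using assms(1) [unfolded analytic_subvariety_def, THEN conjunct2, rule_format, OF assms(2)] .
  then show thesis by (elim exE conjE) (rule that)
qed

text \<open>At a point of \<open>U - Z\<close> one of the local equations is nonzero, and it stays
  so nearby. Closedness in \<open>U\<close> is what makes small closed balls of a local model
  compact.\<close>

lemma closed_analytic_subvariety:
  assumes Z: "analytic_subvariety N U Z" and U: "open_in_cspace N U"
  shows "open_in_cspace N (U - Z)"
  unfolding open_in_cspace_iff
proof (intro conjI ballI)
  show "U - Z \<subseteq> cspace N" using open_in_cspace_subset [OF U] by blast
  fix w assume w: "w \<in> U - Z"
  then have "w \<in> U" by blast
  then obtain W \<F> where W: "open_in_cspace N W" "w \<in> W" "W \<subseteq> U" "finite \<F>"
    and \<F>: "\<forall>F\<in>\<F>. holomorphic_in N W F" "Z \<inter> W = {x \<in> W. \<forall>F\<in>\<F>. F x = 0}"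
    by (rule analytic_subvarietyE [OF Z])
  obtain F where F: "F \<in> \<F>" "F w \<noteq> 0" using w W(2) \<F>(2) by blast
  have "continuous_on W F" using \<F>(1) F(1) by (simp add: holomorphic_in_def)
  then obtain d where d: "d > 0" "\<forall>z\<in>W. cdist N z w < d \<longrightarrow> dist (F z) (F w) < cmod (F w)"
    unfolding continuous_on_cspace_iff [OF open_in_cspace_subset [OF W(1)]]
    using W(2) F(2) zero_less_norm_iff [of "F w"] by blast
  obtain e where e: "0 < e" "\<And>z. z \<in> cspace N \<Longrightarrow> cdist N z w < e \<Longrightarrow> z \<in> W"
    using open_in_cspaceE [OF W(1,2)] by blast
  show "\<exists>e>0. \<forall>z\<in>cspace N. cdist N z w < e \<longrightarrow> z \<in> U - Z"
  proof (intro exI [of _ "min d e"] conjI ballI impI)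
    fix z assume z: "z \<in> cspace N" "cdist N z w < min d e"
    then have zW: "z \<in> W" using e(2) by simp
    then have "dist (F z) (F w) < cmod (F w)" using d(2) z(2) by simp
    then have "F z \<noteq> 0" by (auto simp: dist_norm)
    then show "z \<in> U - Z" using zW W(3) F(1) \<F>(2) by blast
  qed (use d e in auto)
qed

lemma analytic_subvariety_restrict:
  assumes Z: "analytic_subvariety N U Z" and U': "open_in_cspace N U'" "U' \<subseteq> U"
  shows "analytic_subvariety N U' (Z \<inter> U')"
  unfolding analytic_subvariety_def
proof (intro conjI ballI)
  fix w assume w: "w \<in> U'"
  then have "w \<in> U" using U'(2) by blast
  then obtain W \<F> where W: "open_in_cspace N W" "w \<in> W" "W \<subseteq> U" "finite \<F>"
    and \<F>: "\<forall>F\<in>\<F>. holomorphic_in N W F" "Z \<inter> W = {x \<in> W. \<forall>F\<in>\<F>. F x = 0}"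
    by (rule analytic_subvarietyE [OF Z])
  show "\<exists>W \<F>. open_in_cspace N W \<and> w \<in> W \<and> W \<subseteq> U' \<and> finite \<F> \<and>
      (\<forall>F\<in>\<F>. holomorphic_in N W F) \<and> Z \<inter> U' \<inter> W = {x \<in> W. \<forall>F\<in>\<F>. F x = 0}"
  proof (intro exI [of _ "W \<inter> U'"] exI [of _ \<F>] conjI)
    show "open_in_cspace N (W \<inter> U')" by (rule open_in_cspace_Int [OF W(1) U'(1)])
    show "\<forall>F\<in>\<F>. holomorphic_in N (W \<inter> U') F"
      using \<F>(1) by (meson holomorphic_in_subset inf_le1)
    show "Z \<inter> U' \<inter> (W \<inter> U') = {x \<in> W \<inter> U'. \<forall>F\<in>\<F>. F x = 0}" using \<F>(2) by blast
  qed (use w W in auto)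
qed auto

lemma local_model_isoD:
  assumes "local_model_iso X \<O> \<omega> z N U Z"
  shows "openin X \<omega>" "open_in_cspace N U" "analytic_subvariety N U Z" "Z \<subseteq> U"
    "homeomorphic_map (subtopology X \<omega>) (top_of_set Z) z"
    "z ` \<omega> = Z" "inj_on z \<omega>" "x \<in> \<omega> \<Longrightarrow> z x \<in> cspace N" "x \<in> \<omega> \<Longrightarrow> z x \<in> U"
proof -
  show *: "openin X \<omega>" "open_in_cspace N U" "analytic_subvariety N U Z"
    "homeomorphic_map (subtopology X \<omega>) (top_of_set Z) z"
    using assms by (auto simp: local_model_iso_def)
  show ZU: "Z \<subseteq> U" using *(3) by (simp add: analytic_subvariety_def)
  have t: "topspace (subtopology X \<omega>) = \<omega>"
    by (rule topspace_subtopology_subset [OF openin_subset [OF *(1)]])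
  show im: "z ` \<omega> = Z"
    using homeomorphic_imp_surjective_map [OF *(4)] t by simp
  show "inj_on z \<omega>"
    using homeomorphic_imp_injective_map [OF *(4)] t by simp
  show "x \<in> \<omega> \<Longrightarrow> z x \<in> cspace N" "x \<in> \<omega> \<Longrightarrow> z x \<in> U"
    using im ZU open_in_cspace_subset [OF *(2)] by auto
qed

lemma local_model_iso_open_image:
  assumes iso: "local_model_iso X \<O> \<omega> z N U Z" and V: "openin X V" "V \<subseteq> \<omega>"
  obtains T where "open T" "z ` V = Z \<inter> T"
proof -
  note iso' = local_model_isoD [OF iso]
  have "openin (subtopology X \<omega>) V"
    using V iso'(1) by (simp add: openin_open_subtopology)
  then have "openin (top_of_set Z) (z ` V)"
    using homeomorphic_map_openness_eq [OF iso'(5)] by blast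
  then show thesis using that by (auto simp: openin_open)
qed

lemma local_model_iso_open_preimage:
  assumes iso: "local_model_iso X \<O> \<omega> z N U Z" and W: "open_in_cspace N W"
  shows "openin X {x \<in> \<omega>. z x \<in> W}"
proof -
  note iso' = local_model_isoD [OF iso]
  obtain T where T: "open T" "W = cspace N \<inter> T"
    using W by (auto simp: open_in_cspace_def openin_open)
  have t: "topspace (subtopology X \<omega>) = \<omega>"
    by (rule topspace_subtopology_subset [OF openin_subset [OF iso'(1)]])
  have "openin (subtopology X \<omega>) {x \<in> topspace (subtopology X \<omega>). z x \<in> Z \<inter> T}"
    by (rule openin_continuous_map_preimage [OF homeomorphic_imp_continuous_map [OF iso'(5)]])
      (use T in \<open>auto simp: openin_open\<close>)
  moreover have "{x \<in> topspace (subtopology X \<omega>). z x \<in> Z \<inter> T} = {x \<in> \<omega>. z x \<in> W}"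
    unfolding t using iso'(6,8) T by auto
  ultimately show ?thesis
    using iso'(1) by (simp add: openin_open_subtopology)
qed

text \<open>The smaller image must again be closed in its ambient open set, so \<open>U\<close> has
  to shrink along with the chart: the image is open in \<open>Z\<close>, hence of the form
  \<open>Z \<inter> T\<close>, and \<open>T\<close> is used to cut down \<open>U\<close>.\<close>

lemma local_model_iso_shrink:
  assumes iso: "local_model_iso X \<O> \<omega> z N U Z" and W: "open_in_cspace N W" and V: "openin X V"
  obtains U' Z' where "local_model_iso X \<O> {x \<in> \<omega> \<inter> V. z x \<in> W} z N U' Z'" "U' \<subseteq> U \<inter> W"
proof -
  note iso' = local_model_isoD [OF iso]
  define \<omega>' where "\<omega>' = {x \<in> \<omega> \<inter> V. z x \<in> W}"
  have "\<omega>' = {x \<in> \<omega>. z x \<in> W} \<inter> V" by (auto simp: \<omega>'_def)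
  then have o: "openin X \<omega>'"
    using local_model_iso_open_preimage [OF iso W] V by auto
  have sub: "\<omega>' \<subseteq> \<omega>" by (auto simp: \<omega>'_def)
  obtain T where T: "open T" "z ` \<omega>' = Z \<inter> T"
    using local_model_iso_open_image [OF iso o sub] by blast
  define U' where "U' = U \<inter> W \<inter> T"
  have "open_in_cspace N (U \<inter> W)" by (rule open_in_cspace_Int [OF iso'(2) W])
  then have U': "open_in_cspace N U'"
    unfolding U'_def open_in_cspace_def using T(1) by (simp add: openin_Int_open)
  have mem: "z x \<in> U' \<longleftrightarrow> x \<in> \<omega>'" if x: "x \<in> \<omega>" for x
  proof
    assume "z x \<in> U'"
    then have "z x \<in> z ` \<omega>'" using T(2) iso'(6) x by (auto simp: U'_def)
    then show "x \<in> \<omega>'" using iso'(7) x sub by (auto dest: inj_onD)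
  next
    assume x': "x \<in> \<omega>'"
    then have "z x \<in> Z \<inter> T" using T(2) by blast
    then show "z x \<in> U'" using x' iso'(4) by (auto simp: U'_def \<omega>'_def)
  qed
  have t: "topspace (subtopology X \<omega>) = \<omega>"
    by (rule topspace_subtopology_subset [OF openin_subset [OF iso'(1)]])
  have "homeomorphic_map (subtopology (subtopology X \<omega>) \<omega>') (subtopology (top_of_set Z) U') z"
    by (rule homeomorphic_map_subtopologies_alt [OF iso'(5)]) (use mem t in auto)
  then have hom: "homeomorphic_map (subtopology X \<omega>') (top_of_set (Z \<inter> U')) z"
    using sub by (simp add: subtopology_subtopology Int_absorb1)
  have "local_model_iso X \<O> \<omega>' z N U' (Z \<inter> U')"
    unfolding local_model_iso_def
  proof (intro conjI allI impI)
    show "analytic_subvariety N U' (Z \<inter> U')"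
      by (rule analytic_subvariety_restrict [OF iso'(3) U']) (auto simp: U'_def)
    fix V f assume V: "openin X V \<and> V \<subseteq> \<omega>'"
    then show "f \<in> \<O> V \<longleftrightarrow> (\<forall>x\<in>V. \<exists>W F. open_in_cspace N W \<and> z x \<in> W \<and> holomorphic_in N W F \<and>
             (\<forall>y\<in>V. z y \<in> W \<longrightarrow> f y = F (z y)))"
      using iso sub unfolding local_model_iso_def by auto
  qed (use o U' hom in auto)
  then show thesis
    by (intro that [of U' "Z \<inter> U'"]) (auto simp: U'_def \<omega>'_def)
qed

text \<open>Inside its open factor \<open>V\<close> the set \<open>A\<close> agrees with its closed
  factor \<open>F\<close>. A small closed ball of the ambient space pulls back to a compact set
  contained in \<open>V\<close>, whose intersection with \<open>F\<close> is therefore compact and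
  equal to that with \<open>A\<close>.\<close>

lemma locally_closed_compact_neighbourhood:
  assumes A: "locally_closed_in X A"
    and iso: "local_model_iso X \<O> \<omega> z N U Z"
    and S: "openin (subtopology X A) S" and p: "p \<in> S" "p \<in> \<omega>"
  obtains \<delta> where "0 < \<delta>" "compactin X {x \<in> A \<inter> \<omega>. cdist N (z x) (z p) \<le> \<delta>}"
    "{x \<in> A \<inter> \<omega>. cdist N (z x) (z p) \<le> \<delta>} \<subseteq> S"
proof -
  note iso' = local_model_isoD [OF iso]
  obtain V F where VF: "openin X V" "closedin X F" "A = V \<inter> F"
    using A by (auto simp: locally_closed_in_def)
  obtain S' where S': "openin X S'" "S = S' \<inter> A" using S by (auto simp: openin_subtopology)
  define \<omega>1 where "\<omega>1 = \<omega> \<inter> S' \<inter> V"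
  have o: "openin X \<omega>1" "\<omega>1 \<subseteq> \<omega>" using iso'(1) S'(1) VF(1) by (auto simp: \<omega>1_def)
  have p1: "p \<in> \<omega>1" using p S'(2) VF(3) by (auto simp: \<omega>1_def)
  obtain T where T: "open T" "z ` \<omega>1 = Z \<inter> T"
    using local_model_iso_open_image [OF iso o] by blast
  have "open_in_cspace N (U \<inter> T)"
    using iso'(2) T(1) by (simp add: open_in_cspace_def openin_Int_open)
  moreover have "z p \<in> U \<inter> T" using T(2) p1 iso'(4) by blast
  ultimately obtain e where e: "0 < e" "\<And>w. w \<in> cspace N \<Longrightarrow> cdist N w (z p) < e \<Longrightarrow> w \<in> U \<inter> T"
    using open_in_cspaceE by blast
  define \<delta> where "\<delta> = e / 2"
  define B where "B = {w \<in> cspace N. cdist N w (z p) \<le> \<delta>}"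
  have B: "B \<subseteq> U \<inter> T" using e by (auto simp: B_def \<delta>_def)
  obtain T' where T': "open T'" "U - Z = cspace N \<inter> T'"
    using closed_analytic_subvariety [OF iso'(3,2)] by (auto simp: open_in_cspace_def openin_open)
  \<comment> \<open>\<open>Z\<close> is closed in \<open>U\<close> only; as \<open>B\<close> lies in
    \<open>U\<close>, removing the open \<open>T'\<close> from the compact ball leaves a compact
    set.\<close>
  have "Z \<inter> B = B \<inter> - T'" using T'(2) B iso'(4) unfolding B_def by blast
  then have "compact (Z \<inter> B)"
    using compact_cspace_cball T'(1) unfolding B_def by (simp add: compact_Int_closed closed_Compl)
  define L where "L = {x \<in> \<omega>. z x \<in> B}"
  have "z ` L = Z \<inter> B" using iso'(6) by (auto simp: L_def)
  then have "compactin (top_of_set Z) (z ` L)"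
    using \<open>compact (Z \<inter> B)\<close> by (simp add: compactin_subtopology)
  moreover have "L \<subseteq> topspace (subtopology X \<omega>)"
    using openin_subset [OF iso'(1)] by (auto simp: L_def)
  ultimately have "compactin (subtopology X \<omega>) L"
    using homeomorphic_map_compactness_eq [OF iso'(5)] by blast
  then have cL: "compactin X L" by (simp add: compactin_subtopology)
  have L1: "L \<subseteq> \<omega>1"
  proof
    fix x assume x: "x \<in> L"
    then have "z x \<in> z ` \<omega>1" using T(2) B iso'(6) by (auto simp: L_def)
    then show "x \<in> \<omega>1" using x o(2) iso'(7) by (auto simp: L_def dest: inj_onD)
  qed
  have eq: "{x \<in> A \<inter> \<omega>. cdist N (z x) (z p) \<le> \<delta>} = F \<inter> L"
    using L1 VF(3) iso'(8) by (auto simp: L_def B_def \<omega>1_def)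
  show thesis
  proof (rule that [of \<delta>])
    show "0 < \<delta>" using e(1) by (simp add: \<delta>_def)
    show "compactin X {x \<in> A \<inter> \<omega>. cdist N (z x) (z p) \<le> \<delta>}"
      unfolding eq by (rule closed_Int_compactin [OF VF(2) cL])
    show "{x \<in> A \<inter> \<omega>. cdist N (z x) (z p) \<le> \<delta>} \<subseteq> S"
      unfolding eq using L1 VF(3) S'(2) by (auto simp: \<omega>1_def)
  qed
qed

section \<open>Peak points\<close>

text \<open>The inequality is imposed on all of \<open>A \<inter> \<omega>\<close>, but charts may
  be shrunk, so this is a local condition at \<open>p\<close>.\<close>

definition peak_at ::
    "'a topology \<Rightarrow> ('a set \<Rightarrow> ('a \<Rightarrow> complex) set) \<Rightarrow> 'a set \<Rightarrow> ('a \<Rightarrow> complex) \<Rightarrow> 'a \<Rightarrow> bool" where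
  "peak_at X \<O> A f p \<longleftrightarrow>
     (\<exists>\<omega> z N U Z G \<epsilon>. p \<in> \<omega> \<and> local_model_iso X \<O> \<omega> z N U Z \<and> holomorphic_in N U G \<and> 0 < \<epsilon> \<and>
        f p * G (z p) \<noteq> 0 \<and>
        (\<forall>x\<in>A \<inter> \<omega>. cmod (f x * G (z x)) \<le> cmod (f p * G (z p)) * exp (- \<epsilon> * (cdist N (z x) (z p))\<^sup>2)))"

lemma peak_atI:
  assumes iso: "local_model_iso X \<O> \<omega> z N U Z" and V: "openin X V" "p \<in> \<omega>" "p \<in> V"
    and W: "open_in_cspace N W" "z p \<in> W" and G: "holomorphic_in N W G" and "0 < \<epsilon>"
    and "f p * G (z p) \<noteq> 0"
    and le: "\<And>x. x \<in> A \<Longrightarrow> x \<in> \<omega> \<Longrightarrow> x \<in> V \<Longrightarrow> z x \<in> W \<Longrightarrow>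
      cmod (f x * G (z x)) \<le> cmod (f p * G (z p)) * exp (- \<epsilon> * (cdist N (z x) (z p))\<^sup>2)"
  shows "peak_at X \<O> A f p"
proof -
  obtain U' Z' where iso': "local_model_iso X \<O> {x \<in> \<omega> \<inter> V. z x \<in> W} z N U' Z'" and U': "U' \<subseteq> U \<inter> W"
    by (rule local_model_iso_shrink [OF iso W(1) V(1)])
  show ?thesis
    unfolding peak_at_def
  proof (intro exI conjI)
    show "local_model_iso X \<O> {x \<in> \<omega> \<inter> V. z x \<in> W} z N U' Z'" by (rule iso')
    show "holomorphic_in N U' G" using holomorphic_in_subset [OF G] U' by blast
  qed (use assms in auto)
qed

lemma peak_atE:
  assumes "peak_at X \<O> A f p"
  obtains \<omega> z N U Z G \<epsilon> where "p \<in> \<omega>" "local_model_iso X \<O> \<omega> z N U Z" "holomorphic_in N U G" "0 < \<epsilon>"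
    "f p * G (z p) \<noteq> 0"
    "\<And>x. x \<in> A \<Longrightarrow> x \<in> \<omega> \<Longrightarrow>
      cmod (f x * G (z x)) \<le> cmod (f p * G (z p)) * exp (- \<epsilon> * (cdist N (z x) (z p))\<^sup>2)"
proof -
  obtain \<omega> z N U Z G \<epsilon> where
    *: "p \<in> \<omega>" "local_model_iso X \<O> \<omega> z N U Z" "holomorphic_in N U G" "0 < \<epsilon>"
      "f p * G (z p) \<noteq> 0"
      "\<forall>x\<in>A \<inter> \<omega>. cmod (f x * G (z x)) \<le> cmod (f p * G (z p)) * exp (- \<epsilon> * (cdist N (z x) (z p))\<^sup>2)"
    using assms unfolding peak_at_def by (elim exE conjE)
  show thesis
    by (rule that [OF *(1-5)]) (use *(6) in blast)
qed

text \<open>The closure defining LACR functions is taken among sets of germs, so peaks have to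
  depend on the germ along \<open>A\<close> alone.\<close>

lemma peak_at_cong:
  assumes f: "peak_at X \<O> A f p" and S: "openin (subtopology X A) S" "p \<in> S"
    and eq: "\<And>x. x \<in> S \<Longrightarrow> g x = f x"
  shows "peak_at X \<O> A g p"
proof -
  obtain V where V: "openin X V" "S = V \<inter> A" using S(1) by (auto simp: openin_subtopology)
  from f show ?thesis
  proof (rule peak_atE)
    fix \<omega> z N U Z G \<epsilon>
    assume *: "p \<in> \<omega>" "local_model_iso X \<O> \<omega> z N U Z" "holomorphic_in N U G" "0 < (\<epsilon>::real)"
      "f p * G (z p) \<noteq> 0"
      and le: "\<And>x. x \<in> A \<Longrightarrow> x \<in> \<omega> \<Longrightarrow>
        cmod (f x * G (z x)) \<le> cmod (f p * G (z p)) * exp (- \<epsilon> * (cdist N (z x) (z p))\<^sup>2)"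
    have pV: "p \<in> V" using S(2) V(2) by blast
    show ?thesis
    proof (rule peak_atI [OF *(2) V(1) *(1) pV local_model_isoD(2) [OF *(2)]
          local_model_isoD(9) [OF *(2,1)] *(3,4)])
      show "g p * G (z p) \<noteq> 0" using *(5) eq [OF S(2)] by simp
      show "cmod (g x * G (z x)) \<le> cmod (g p * G (z p)) * exp (- \<epsilon> * (cdist N (z x) (z p))\<^sup>2)"
        if "x \<in> A" "x \<in> \<omega>" "x \<in> V" for x
        using le [of x] eq [of x] eq [OF S(2)] that V(2) by simp
    qed
  qed
qed

text \<open>Trades Gaussian decay for quadratic decay at the cost of a factor \<open>2\<close>, by
  \<open>1 + s \<le> exp s\<close> and \<open>1 \<le> (1 + s) * (1 - s / 2)\<close>.\<close>

lemma exp_minus_le_linear: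
  fixes s :: real
  assumes "0 \<le> s" "s \<le> 1"
  shows "exp (- s) \<le> 1 - s / 2"
proof -
  have "s * s \<le> s * 1" by (rule mult_left_mono) (use assms in auto)
  then have "1 \<le> (1 + s) * (1 - s / 2)" by (simp add: algebra_simps)
  also have "\<dots> \<le> exp s * (1 - s / 2)"
    using assms exp_ge_add_one_self [of s] by (intro mult_right_mono) auto
  finally show ?thesis by (simp add: exp_minus field_simps)
qed

lemma peak_of_holomorphic_imp_pseudoconvex_at:
  assumes X: "reduced_complex_space X \<O>" and p: "p \<in> A"
    and W0: "openin X W0" "p \<in> W0" "f \<in> \<O> W0" and f: "peak_at X \<O> A f p"
  shows "pseudoconvex_at X \<O> 1 A p"
  using f
proof (rule peak_atE)
  fix \<omega> z N U Z G \<epsilon>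
  assume p\<omega>: "p \<in> \<omega>" and iso: "local_model_iso X \<O> \<omega> z N U Z" and G: "holomorphic_in N U G"
    and \<epsilon>: "0 < (\<epsilon>::real)" and nz: "f p * G (z p) \<noteq> 0"
    and le: "\<And>x. x \<in> A \<Longrightarrow> x \<in> \<omega> \<Longrightarrow>
      cmod (f x * G (z x)) \<le> cmod (f p * G (z p)) * exp (- \<epsilon> * (cdist N (z x) (z p))\<^sup>2)"
  note isoD = local_model_isoD [OF iso]
  define V where "V = \<omega> \<inter> W0"
  have V: "openin X V" "V \<subseteq> \<omega>" "p \<in> V" using isoD(1) W0 p\<omega> by (auto simp: V_def)
  have "f \<in> \<O> V"
    by (rule reduced_complex_space.sheaf_restrict [OF X W0(1) V(1) _ W0(3)]) (auto simp: V_def)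
  then have "\<forall>x\<in>V. \<exists>W F. open_in_cspace N W \<and> z x \<in> W \<and> holomorphic_in N W F \<and>
      (\<forall>y\<in>V. z y \<in> W \<longrightarrow> f y = F (z y))"
    using iso V(1,2) unfolding local_model_iso_def by blast
  then obtain W F where W: "open_in_cspace N W" "z p \<in> W" "holomorphic_in N W F"
    and F: "\<And>y. y \<in> V \<Longrightarrow> z y \<in> W \<Longrightarrow> f y = F (z y)"
    using V(3) by meson
  define c where "c = f p * G (z p)"
  define K where "K = (\<lambda>w. F w * G w * (1 / c))"
  \<comment> \<open>On this ball the exponent \<open>s\<close> below is at most \<open>1\<close>, as
    \<open>exp_minus_le_linear\<close> demands.\<close>
  define B where "B = {w \<in> cspace N. cdist N w (z p) < sqrt (1 / \<epsilon>)}"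
  define W' where "W' = W \<inter> B"
  have W': "open_in_cspace N W'"
    unfolding W'_def B_def by (rule open_in_cspace_Int [OF W(1) open_in_cspace_ball])
  have zpW': "z p \<in> W'" using W(2) isoD(8) [OF p\<omega>] \<epsilon> by (simp add: W'_def B_def)
  obtain U' Z' where iso': "local_model_iso X \<O> {x \<in> \<omega> \<inter> V. z x \<in> W'} z N U' Z'" and U': "U' \<subseteq> U \<inter> W'"
    by (rule local_model_iso_shrink [OF iso W' V(1)])
  define \<omega>' where "\<omega>' = {x \<in> \<omega> \<inter> V. z x \<in> W'}"
  note iso'' = iso' [folded \<omega>'_def]
  note isoD' = local_model_isoD [OF iso'']
  have p': "p \<in> \<omega>'" using p\<omega> V(3) zpW' by (simp add: \<omega>'_def)
  have K: "holomorphic_in N U' K"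
    unfolding K_def
  proof (intro holomorphic_in_mult holomorphic_in_const)
    show "holomorphic_in N U' F" by (rule holomorphic_in_subset [OF W(3)]) (use U' W'_def in blast)
    show "holomorphic_in N U' G" by (rule holomorphic_in_subset [OF G]) (use U' in blast)
  qed
  have Kf: "K (z x) = f x * G (z x) / c" if "x \<in> \<omega>'" for x
    using F [of x] that by (simp add: K_def \<omega>'_def W'_def)
  \<comment> \<open>By \<open>exp_minus_le_linear\<close> the Gaussian leaves room for a quadratic
    term with half its rate.\<close>
  define \<psi> where "\<psi> = (\<lambda>w. Re (K w) + (\<epsilon> / 2) * (cdist N w (z p))\<^sup>2)"
  have \<psi>p: "\<psi> (z p) = 1" using Kf [OF p'] nz by (simp add: \<psi>_def c_def)
  have \<psi>le: "\<psi> (z x) \<le> 1" if x: "x \<in> A" "x \<in> \<omega>'" for x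
  proof -
    define s where "s = \<epsilon> * (cdist N (z x) (z p))\<^sup>2"
    have "z x \<in> B" using x(2) by (simp add: \<omega>'_def W'_def)
    then have "(cdist N (z x) (z p))\<^sup>2 \<le> (sqrt (1 / \<epsilon>))\<^sup>2"
      unfolding B_def by (intro power_mono) auto
    then have s: "0 \<le> s" "s \<le> 1" using \<epsilon> by (auto simp: s_def field_simps)
    have "Re (K (z x)) \<le> cmod (K (z x))" by (rule complex_Re_le_cmod)
    also have "\<dots> \<le> exp (- s)"
    proof -
      have "cmod (f x * G (z x)) \<le> cmod c * exp (- s)"
        using le [of x] x by (simp add: \<omega>'_def c_def s_def)
      moreover have "0 < cmod c" using nz by (simp add: c_def)
      ultimately show ?thesis
        unfolding Kf [OF x(2)] norm_divide by (simp add: pos_divide_le_eq mult.commute)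
    qed
    also have "\<dots> \<le> 1 - s / 2" by (rule exp_minus_le_linear [OF s])
    finally show ?thesis by (simp add: \<psi>_def s_def)
  qed
  have "num_pos_eigenvalues (complex_hessian N \<psi> (z p)) = N"
    unfolding \<psi>_def complex_hessian_Re_cdist [OF isoD'(2) K isoD'(9) [OF p']]
    by (rule num_pos_eigenvalues_scalar) (use \<epsilon> in simp)
  \<comment> \<open>For \<open>q = 1\<close> the required number \<open>N - q + 1\<close> of
    positive eigenvalues is all of \<open>N\<close>.\<close>
  then have eig: "int (num_pos_eigenvalues (complex_hessian N \<psi> (z p))) \<ge> int N - 1 + 1" by simp
  show "pseudoconvex_at X \<O> 1 A p"
    unfolding pseudoconvex_at_def
  proof (intro exI conjI)
    show "local_model_iso X \<O> \<omega>' z N U' Z'" by (rule iso'')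
    show "C_infinity N U' \<psi>" unfolding \<psi>_def by (rule C_infinity_Re_cdist [OF isoD'(2) K])
    show "z ` (A \<inter> \<omega>') \<subseteq> {w \<in> U'. \<psi> w \<le> \<psi> (z p)}"
      using \<psi>le isoD'(9) \<psi>p by auto
    show "int N - 1 + 1 \<le> int (num_pos_eigenvalues (complex_hessian N \<psi> (z p)))" by (rule eig)
  qed (use p' isoD'(1) in auto)
qed

text \<open>The cross term is the real part of an affine holomorphic function of \<open>w\<close>.
  Hence two Gaussians of equal rate with different centres differ by a constant times the modulus of
  a nowhere vanishing holomorphic function.\<close>

lemma cdist_square_recentre:
  "(cdist N w p)\<^sup>2 = (cdist N w q)\<^sup>2 + 2 * Re (\<Sum>i<N. (w i - q i) * cnj (q i - p i)) + (cdist N q p)\<^sup>2"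
proof -
  have "(cmod (w i - p i))\<^sup>2 = (cmod (w i - q i))\<^sup>2 + 2 * Re ((w i - q i) * cnj (q i - p i)) + (cmod (q i - p i))\<^sup>2" for i
    by (simp add: cmod_power2; simp add: power2_eq_square algebra_simps)
  then show ?thesis
    by (simp only: cdist_square sum.distrib Re_sum sum_distrib_left [symmetric])
qed

text \<open>A strict peak of the limit forces a nearby maximum of \<open>|g n|\<close> times half of the Gaussian
  weight; recentring the Gaussian there only changes the holomorphic factor.\<close>

lemma peak_of_locally_uniform_limit:
  assumes A: "locally_closed_in X A" and S: "openin (subtopology X A) S" "p \<in> S"
    and cont: "\<And>n. continuous_fun X S (g n)"
    and lim: "\<And>K. compactin X K \<Longrightarrow> K \<subseteq> S \<Longrightarrow> uniform_limit K g f sequentially"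
    and f: "peak_at X \<O> A f p"
  shows "\<exists>n q. q \<in> S \<and> peak_at X \<O> A (g n) q"
  using f
proof (rule peak_atE)
  fix \<omega> z N U Z G \<epsilon>
  assume p\<omega>: "p \<in> \<omega>" and iso: "local_model_iso X \<O> \<omega> z N U Z" and G: "holomorphic_in N U G"
    and \<epsilon>: "0 < (\<epsilon>::real)" and nz: "f p * G (z p) \<noteq> 0"
    and le: "\<And>x. x \<in> A \<Longrightarrow> x \<in> \<omega> \<Longrightarrow>
      cmod (f x * G (z x)) \<le> cmod (f p * G (z p)) * exp (- \<epsilon> * (cdist N (z x) (z p))\<^sup>2)"
  note isoD = local_model_isoD [OF iso]
  have SA: "S \<subseteq> A" using openin_subset [OF S(1)] by auto
  obtain \<delta> where \<delta>: "0 < \<delta>" "compactin X {x \<in> A \<inter> \<omega>. cdist N (z x) (z p) \<le> \<delta>}"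
    "{x \<in> A \<inter> \<omega>. cdist N (z x) (z p) \<le> \<delta>} \<subseteq> S"
    by (rule locally_closed_compact_neighbourhood [OF A iso S p\<omega>])
  define K where "K = {x \<in> A \<inter> \<omega>. cdist N (z x) (z p) \<le> \<delta>}"
  have K: "compactin X K" "K \<subseteq> S" "K \<subseteq> \<omega>" using \<delta> by (auto simp: K_def)
  have pK: "p \<in> K" using S(2) SA p\<omega> \<delta>(1) by (auto simp: K_def)
  \<comment> \<open>The weight undoes half of the decay of \<open>f\<close>. The half that remains
    gives the gap on the sphere of radius \<open>\<delta>\<close>; the half taken out becomes,
    recentred, the decay of \<open>g n\<close> at its maximum.\<close>
  define w where "w = (\<lambda>x. exp (\<epsilon> / 2 * (cdist N (z x) (z p))\<^sup>2))"
  define h where "h = (\<lambda>x. cmod (G (z x)) * w x)"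
  define u where "u = (\<lambda>n x. cmod (g n x) * h x)"
  define M where "M = cmod (f p * G (z p))"
  have M: "0 < M" using nz by (simp add: M_def)
  have w0: "w p = 1" "\<And>x. 0 < w x" by (auto simp: w_def)
  have contz: "continuous_map (subtopology X K) euclidean (\<lambda>x. \<phi> (z x))"
    if "continuous_on U \<phi>" for \<phi> :: "(nat \<Rightarrow> complex) \<Rightarrow> real"
  proof -
    have "continuous_map (subtopology X \<omega>) (top_of_set Z) z"
      by (rule homeomorphic_imp_continuous_map [OF isoD(5)])
    then have "continuous_map (subtopology X K) (top_of_set Z) z"
      by (rule continuous_map_from_subtopology_mono [OF _ K(3)])
    moreover have "continuous_map (top_of_set Z) euclidean \<phi>"
      using that isoD(4) by (simp add: continuous_on_subset)
    ultimately have "continuous_map (subtopology X K) euclidean (\<phi> \<circ> z)"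
      by (rule continuous_map_compose)
    then show ?thesis by (simp add: o_def)
  qed
  have conth: "continuous_map (subtopology X K) euclidean h"
    unfolding h_def w_def
    by (rule contz) (use G in \<open>auto simp: holomorphic_in_def intro!: continuous_intros continuous_on_cdist\<close>)
  have contu: "continuous_map (subtopology X K) euclidean (u n)" for n
  proof -
    have "continuous_map (subtopology X K) euclidean (g n)"
      by (rule continuous_map_from_subtopology_mono [OF cont [of n, unfolded continuous_fun_def] K(2)])
    then have "continuous_map (subtopology X K) euclidean (\<lambda>x. cmod (g n x))"
      by (rule continuous_map_norm)
    then show ?thesis
      unfolding u_def by (intro continuous_map_real_mult conth)
  qed
  have cK: "compactin (subtopology X K) K"
    using K(1) by (simp add: compactin_subtopology)
  have "compact (h ` K)"
    using image_compactin [OF cK conth] by simp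
  then obtain C where C: "\<And>x. x \<in> K \<Longrightarrow> h x \<le> C"
    using compact_imp_bounded [of "h ` K"] bounded_imp_bdd_above [of "h ` K"]
    unfolding bdd_above_def by blast
  have C0: "0 \<le> C" using C [OF pK] w0 by (simp add: h_def order_trans [OF norm_ge_zero])
  \<comment> \<open>The drop of the bound for \<open>cmod (f x) * h x\<close> from the centre to
    distance \<open>\<delta>\<close>.\<close>
  define e where "e = M * (1 - exp (- (\<epsilon> / 2 * \<delta>\<^sup>2)))"
  have e: "0 < e" using M \<epsilon> \<delta>(1) by (simp add: e_def)
  have "uniform_limit K g f sequentially" using lim K by blast
  \<comment> \<open>With this tolerance multiplication by \<open>h \<le> C\<close> keeps the error
    below \<open>e / 2\<close>; the added \<open>1\<close> covers \<open>C = 0\<close>.\<close>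
  then have "\<forall>\<^sub>F n in sequentially. \<forall>x\<in>K. dist (g n x) (f x) < e / (2 * C + 1)"
    using e C0 by (intro uniform_limitD) auto
  then obtain n where n: "\<And>x. x \<in> K \<Longrightarrow> dist (g n x) (f x) < e / (2 * C + 1)"
    unfolding eventually_sequentially by blast
  have close: "\<bar>u n x - cmod (f x) * h x\<bar> < e / 2" if x: "x \<in> K" for x
  proof -
    have h0: "0 \<le> h x" using w0(2) [of x] by (simp add: h_def)
    have "\<bar>cmod (g n x) - cmod (f x)\<bar> \<le> e / (2 * C + 1)"
      using norm_triangle_ineq3 [of "g n x" "f x"] n [OF x] by (simp add: dist_norm)
    then have "\<bar>cmod (g n x) - cmod (f x)\<bar> * h x \<le> e / (2 * C + 1) * C"
      using C [OF x] C0 h0 e by (intro mult_mono) auto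
    also have "\<dots> < e / 2" using e C0 by (simp add: field_simps)
    finally show ?thesis using h0 by (simp add: u_def left_diff_distrib [symmetric] abs_mult)
  qed
  have "compact (u n ` K)"
    using image_compactin [OF cK contu] by simp
  then obtain q where q: "q \<in> K" "\<And>x. x \<in> K \<Longrightarrow> u n x \<le> u n q"
    using compact_attains_sup [of "u n ` K"] pK by auto
  have "cmod (f p) * h p = M"
    using w0(1) by (simp add: M_def h_def norm_mult)
  then have "M - e / 2 < u n p"
    using close [OF pK] by linarith
  then have uq: "M - e / 2 < u n q" using q(2) [OF pK] by simp
  have fh: "cmod (f x) * h x \<le> M * exp (- (\<epsilon> / 2 * (cdist N (z x) (z p))\<^sup>2))" if x: "x \<in> K" for x
  proof -
    have "cmod (f x) * h x = cmod (f x * G (z x)) * w x" by (simp add: h_def norm_mult)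
    also have "\<dots> \<le> (M * exp (- \<epsilon> * (cdist N (z x) (z p))\<^sup>2)) * w x"
      using le [of x] x w0(2) [of x] by (intro mult_right_mono) (auto simp: K_def M_def)
    also have "\<dots> = M * exp (- (\<epsilon> / 2 * (cdist N (z x) (z p))\<^sup>2))"
      unfolding w_def by (simp add: mult.assoc exp_add [symmetric])
    finally show ?thesis .
  qed
  \<comment> \<open>A peak is an inequality on a full neighbourhood in \<open>A\<close>, but
    \<open>q\<close> is a maximum over the closed ball \<open>K\<close> only, so the bounding sphere
    must be excluded.\<close>
  have qin: "cdist N (z q) (z p) < \<delta>"
  proof (rule ccontr)
    assume "\<not> cdist N (z q) (z p) < \<delta>"
    then have "cdist N (z q) (z p) = \<delta>" using q(1) by (simp add: K_def)
    then have "cmod (f q) * h q \<le> M - e"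
      using fh [OF q(1)] by (simp add: e_def algebra_simps)
    then show False using close [OF q(1)] uq by linarith
  qed
  have "e < M" using M by (simp add: e_def)
  then have uq0: "0 < u n q" using uq e by linarith
  \<comment> \<open>Up to a constant, this exponential converts the Gaussian centred at
    \<open>z p\<close> into the one centred at \<open>z q\<close>, by
    \<open>cdist_square_recentre\<close>; it is \<open>1\<close> at \<open>z q\<close>.\<close>
  define G' where "G' = (\<lambda>v. G v * exp (of_real \<epsilon> * (\<Sum>i<N. (v i - z q i) * cnj (z q i - z p i))))"
  have G': "holomorphic_in N U G'"
    unfolding G'_def by (intro holomorphic_in_intros G)
  have G'q: "G' (z q) = G (z q)" by (simp add: G'_def)
  have nG': "cmod (g n x * G' (z x)) = u n x * exp (- (\<epsilon> / 2 * (cdist N (z x) (z q))\<^sup>2) - \<epsilon> / 2 * (cdist N (z q) (z p))\<^sup>2)" for x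
  proof -
    have "cmod (g n x * G' (z x)) = cmod (g n x) * cmod (G (z x)) *
        exp (\<epsilon> * Re (\<Sum>i<N. (z x i - z q i) * cnj (z q i - z p i)))"
      unfolding G'_def norm_mult norm_exp_eq_Re by simp
    also have "\<epsilon> * Re (\<Sum>i<N. (z x i - z q i) * cnj (z q i - z p i)) =
        \<epsilon> / 2 * (cdist N (z x) (z p))\<^sup>2 + (- (\<epsilon> / 2 * (cdist N (z x) (z q))\<^sup>2) - \<epsilon> / 2 * (cdist N (z q) (z p))\<^sup>2)"
      unfolding cdist_square_recentre [of N "z x" "z p" "z q"] by (simp add: algebra_simps)
    finally show ?thesis
      unfolding exp_add u_def h_def w_def by simp
  qed
  define W where "W = {v \<in> cspace N. cdist N v (z p) < \<delta>} \<inter> U"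
  have W: "open_in_cspace N W"
    unfolding W_def by (rule open_in_cspace_Int [OF open_in_cspace_ball isoD(2)])
  have q\<omega>: "q \<in> \<omega>" using q(1) K(3) by blast
  have "peak_at X \<O> A (g n) q"
  proof (rule peak_atI [OF iso isoD(1) q\<omega> q\<omega> W])
    show "z q \<in> W" using qin isoD(8,9) [OF q\<omega>] by (simp add: W_def)
    show "holomorphic_in N W G'" by (rule holomorphic_in_subset [OF G']) (simp add: W_def)
    show "0 < \<epsilon> / 2" using \<epsilon> by simp
    show "g n q * G' (z q) \<noteq> 0" using nG' [of q] uq0 by auto
    fix x assume x: "x \<in> A" "x \<in> \<omega>" "z x \<in> W"
    then have "x \<in> K" by (simp add: K_def W_def)
    then have "u n x \<le> u n q" by (rule q(2))
    then have "cmod (g n x * G' (z x)) \<le> u n q * exp (- (\<epsilon> / 2 * (cdist N (z x) (z q))\<^sup>2) - \<epsilon> / 2 * (cdist N (z q) (z p))\<^sup>2)"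
      unfolding nG' by (intro mult_right_mono) auto
    also have "\<dots> = cmod (g n q * G' (z q)) * exp (- (\<epsilon> / 2) * (cdist N (z x) (z q))\<^sup>2)"
      unfolding nG' by (simp add: mult.assoc exp_add [symmetric])
    finally show "cmod (g n x * G' (z x)) \<le> cmod (g n q * G' (z q)) * exp (- (\<epsilon> / 2) * (cdist N (z x) (z q))\<^sup>2)" .
  qed
  then show ?thesis using q(1) K(2) by blast
qed

section \<open>Maximum principle\<close>

text \<open>Equal germs share their members, and \<open>f\<close> lies in its own germ with all of
  \<open>A\<close> as neighbourhood.\<close>

lemma germ_at_eqD:
  assumes "germ_at X A x f = germ_at X A y g" "x \<in> A" "A \<subseteq> topspace X"
  obtains V where "x = y" "openin (subtopology X A) V" "x \<in> V" "\<And>w. w \<in> V \<Longrightarrow> f w = g w"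
proof -
  have xy: "x = y" using assms(1) by (simp add: germ_at_def)
  have "openin (subtopology X A) A"
    using assms(3) by (simp add: openin_subtopology_refl)
  then have "f \<in> snd (germ_at X A x f)" using assms(2) by (auto simp: germ_at_def)
  then have "f \<in> snd (germ_at X A y g)" using assms(1) by simp
  then show thesis using that xy by (auto simp: germ_at_def)
qed

text \<open>\<open>c_closure\<close> is the intersection of all germ sets that contain the given one
  and are stable under \<open>c_step\<close>, so it suffices that one such set, \<open>\<G>\<close>,
  consists of germs without peaks. A peak of a limit at \<open>y\<close> only yields a peak of some
  \<open>g n\<close> at another point \<open>q\<close>; this still contradicts \<open>g n\<close>
  being a section, since sections are constrained at every point of the open set.\<close>

lemma LACR_not_peak_at:
  assumes X: "reduced_complex_space X \<O>" and A: "locally_closed_in X A"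
    and pc: "weakly_pseudoconcave X \<O> 1 A" and D: "openin (subtopology X A) D"
    and f: "f \<in> LACR X \<O> A D" and p: "p \<in> D"
  shows "\<not> peak_at X \<O> A f p"
proof -
  have AX: "A \<subseteq> topspace X"
    using A unfolding locally_closed_in_def by (meson le_infI1 openin_subset order_trans order_refl)
  define \<G> where "\<G> = {germ_at X A x g | x g. \<exists>S. openin (subtopology X A) S \<and> x \<in> S \<and>
      (\<forall>y\<in>S. \<not> peak_at X \<O> A g y)}"
  have not_peak: "\<not> peak_at X \<O> A g x" if germ: "germ_at X A x g \<in> \<G>" and x: "x \<in> A" for x g
  proof
    assume g: "peak_at X \<O> A g x"
    obtain y g' S where eq: "germ_at X A x g = germ_at X A y g'" and S: "y \<in> S" "\<forall>y\<in>S. \<not> peak_at X \<O> A g' y"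
      using germ unfolding \<G>_def by blast
    obtain V where V: "x = y" "openin (subtopology X A) V" "x \<in> V" "\<And>w. w \<in> V \<Longrightarrow> g w = g' w"
      using germ_at_eqD [OF eq x AX] by metis
    have "peak_at X \<O> A g' x"
      by (rule peak_at_cong [OF g V(2,3)]) (simp add: V(4))
    then show False using S V(1) by blast
  qed
  have "holomorphic_germs X \<O> A \<subseteq> \<G>"
  proof
    fix \<gamma> assume "\<gamma> \<in> holomorphic_germs X \<O> A"
    then obtain x F W where \<gamma>: "\<gamma> = germ_at X A x F" "x \<in> A" and W: "openin X W" "x \<in> W" "F \<in> \<O> W"
      unfolding holomorphic_germs_def by blast
    have "\<not> peak_at X \<O> A F y" if "y \<in> W \<inter> A" for y
      using peak_of_holomorphic_imp_pseudoconvex_at [OF X, of y A W F] pc that W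
      unfolding weakly_pseudoconcave_def by blast
    moreover have "openin (subtopology X A) (W \<inter> A)"
      using W(1) by (auto simp: openin_subtopology)
    ultimately show "\<gamma> \<in> \<G>" using \<gamma> W(2) unfolding \<G>_def by blast
  qed
  moreover have "c_step X A \<G> \<subseteq> \<G>"
  proof
    fix \<gamma> assume "\<gamma> \<in> c_step X A \<G>"
    then obtain x h S g where \<gamma>: "\<gamma> = germ_at X A x h" and S: "openin (subtopology X A) S" "x \<in> S"
      and g: "\<And>n::nat. g n \<in> sections X A \<G> S"
      and lim: "\<And>K. compactin X K \<and> K \<subseteq> S \<Longrightarrow> uniform_limit K g h sequentially"
      unfolding c_step_def by blast
    have SA: "S \<subseteq> A" using openin_subset [OF S(1)] by auto
    have "\<not> peak_at X \<O> A h y" if y: "y \<in> S" for y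
    proof
      assume "peak_at X \<O> A h y"
      then have "\<exists>n q. q \<in> S \<and> peak_at X \<O> A (g n) q"
        using g lim by (intro peak_of_locally_uniform_limit [OF A S(1) y]) (auto simp: sections_def)
      then obtain n q where q: "q \<in> S" "peak_at X \<O> A (g n) q" by blast
      have "germ_at X A q (g n) \<in> \<G>" using g [of n] q(1) by (simp add: sections_def)
      then show False using not_peak q SA by blast
    qed
    then show "\<gamma> \<in> \<G>" using \<gamma> S unfolding \<G>_def by blast
  qed
  ultimately have "c_closure X A (holomorphic_germs X \<O> A) \<subseteq> \<G>"
    unfolding c_closure_def by blast
  moreover have "germ_at X A p f \<in> c_closure X A (holomorphic_germs X \<O> A)"
    using f p by (simp add: LACR_def sections_def)
  moreover have "p \<in> A" using p openin_subset [OF D] by auto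
  ultimately show ?thesis using not_peak by blast
qed

lemma strictly_psh_on_space_continuous:
  assumes "strictly_psh_on_space X \<O> \<rho>"
  shows "continuous_map X euclidean \<rho>"
proof -
  have "\<exists>\<omega>. openin X \<omega> \<and> p \<in> \<omega> \<and> continuous_map (subtopology X \<omega>) euclidean \<rho>"
    if p: "p \<in> topspace X" for p
  proof -
    obtain \<omega> z N U Z \<rho>' where *: "p \<in> \<omega>" "local_model_iso X \<O> \<omega> z N U Z" "C2_strictly_psh N U \<rho>'"
      "\<forall>x\<in>\<omega>. \<rho> x = \<rho>' (z x)"
      using assms p unfolding strictly_psh_on_space_def by meson
    note isoD = local_model_isoD [OF *(2)]
    have "continuous_on U \<rho>'"
      using *(3) by (simp add: C2_strictly_psh_def numeral_2_eq_2)
    then have "continuous_map (top_of_set Z) euclidean \<rho>'"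
      using isoD(4) by (simp add: continuous_on_subset)
    then have "continuous_map (subtopology X \<omega>) euclidean (\<rho>' \<circ> z)"
      by (rule continuous_map_compose [OF homeomorphic_imp_continuous_map [OF isoD(5)]])
    then have "continuous_map (subtopology X \<omega>) euclidean \<rho>"
      by (rule continuous_map_eq) (use *(4) in auto)
    then show ?thesis using *(1) isoD(1) by blast
  qed
  then obtain \<omega> where \<omega>: "\<And>p. p \<in> topspace X \<Longrightarrow>
      openin X (\<omega> p) \<and> p \<in> \<omega> p \<and> continuous_map (subtopology X (\<omega> p)) euclidean \<rho>"
    by metis
  show ?thesis
    by (rule pasting_lemma [where I = "topspace X" and T = \<omega> and f = "\<lambda>_. \<rho>"]) (use \<omega> in blast)+
qed

text \<open>At such a maximum \<open>cmod (f x)\<close> is at most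
  \<open>cmod (f p) * exp (\<tau> * (\<rho> p - \<rho> x))\<close>; after multiplication by
  \<open>exp (\<tau> * Q)\<close> the holomorphic minorant of \<open>\<rho>\<close> turns this bound
  into a Gaussian of rate \<open>\<tau> * \<epsilon>\<close>.\<close>

lemma weighted_local_max_imp_peak_at:
  assumes \<rho>: "strictly_psh_on_space X \<O> \<rho>" and S: "openin (subtopology X A) S" "p \<in> S"
    and "p \<in> topspace X" and \<tau>: "0 < \<tau>" and nz: "f p \<noteq> 0"
    and max: "\<And>x. x \<in> S \<Longrightarrow> cmod (f x) * exp (\<tau> * \<rho> x) \<le> cmod (f p) * exp (\<tau> * \<rho> p)"
  shows "peak_at X \<O> A f p"
proof -
  obtain \<omega> z N U Z \<rho>' where p\<omega>: "p \<in> \<omega>" and iso: "local_model_iso X \<O> \<omega> z N U Z"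
    and \<rho>': "C2_strictly_psh N U \<rho>'" "\<forall>x\<in>\<omega>. \<rho> x = \<rho>' (z x)"
    using \<rho> \<open>p \<in> topspace X\<close> unfolding strictly_psh_on_space_def by meson
  note isoD = local_model_isoD [OF iso]
  obtain V where V: "openin X V" "S = V \<inter> A" using S(1) by (auto simp: openin_subtopology)
  have pV: "p \<in> V" using S(2) V(2) by blast
  obtain Q \<epsilon> \<delta> where Q: "\<And>V. holomorphic_in N V Q" "Q (z p) = 0" and \<epsilon>: "0 < \<epsilon>" and \<delta>: "0 < \<delta>"
    and minorant: "\<And>w. w \<in> cspace N \<Longrightarrow> cdist N w (z p) < \<delta> \<Longrightarrow>
      \<rho>' (z p) + Re (Q w) + \<epsilon> * (cdist N w (z p))\<^sup>2 \<le> \<rho>' w"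
    using strictly_psh_holomorphic_minorant [OF isoD(2) \<rho>'(1) isoD(9) [OF p\<omega>]] by metis
  define G where "G = (\<lambda>w. exp (of_real \<tau> * Q w))"
  have Gp: "G (z p) = 1" by (simp add: G_def Q(2))
  show ?thesis
  proof (rule peak_atI [OF iso V(1) p\<omega> pV open_in_cspace_ball [of N "z p" \<delta>], where G = G and \<epsilon> = "\<tau> * \<epsilon>"])
    show "z p \<in> {w \<in> cspace N. cdist N w (z p) < \<delta>}" using isoD(8) [OF p\<omega>] \<delta> by simp
    show "holomorphic_in N {w \<in> cspace N. cdist N w (z p) < \<delta>} G"
      unfolding G_def by (intro holomorphic_in_intros Q)
    show "0 < \<tau> * \<epsilon>" using \<tau> \<epsilon> by simp
    show "f p * G (z p) \<noteq> 0" using nz Gp by simp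
    fix x assume x: "x \<in> A" "x \<in> \<omega>" "x \<in> V" "z x \<in> {w \<in> cspace N. cdist N w (z p) < \<delta>}"
    have "x \<in> S" using x V(2) by blast
    have "\<rho> p + Re (Q (z x)) + \<epsilon> * (cdist N (z x) (z p))\<^sup>2 \<le> \<rho> x"
      using minorant [of "z x"] x \<rho>'(2) p\<omega> by simp
    then have "\<tau> * (\<rho> p + Re (Q (z x)) + \<epsilon> * (cdist N (z x) (z p))\<^sup>2) \<le> \<tau> * \<rho> x"
      using \<tau> by (intro mult_left_mono) auto
    then have *: "\<tau> * Re (Q (z x)) \<le> \<tau> * \<rho> x + (- \<tau> * \<rho> p + - (\<tau> * \<epsilon>) * (cdist N (z x) (z p))\<^sup>2)"
      by (simp add: algebra_simps)
    have "cmod (f x * G (z x)) = cmod (f x) * exp (\<tau> * Re (Q (z x)))"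
      by (simp add: G_def norm_mult norm_exp_eq_Re)
    also have "\<dots> \<le> cmod (f x) * exp (\<tau> * \<rho> x + (- \<tau> * \<rho> p + - (\<tau> * \<epsilon>) * (cdist N (z x) (z p))\<^sup>2))"
      using * by (intro mult_left_mono) auto
    also have "\<dots> = (cmod (f x) * exp (\<tau> * \<rho> x)) * exp (- \<tau> * \<rho> p + - (\<tau> * \<epsilon>) * (cdist N (z x) (z p))\<^sup>2)"
      by (simp only: exp_add mult.assoc)
    also have "\<dots> \<le> (cmod (f p) * exp (\<tau> * \<rho> p)) * exp (- \<tau> * \<rho> p + - (\<tau> * \<epsilon>) * (cdist N (z x) (z p))\<^sup>2)"
      by (rule mult_right_mono [OF max [OF \<open>x \<in> S\<close>]]) simp
    also have "\<dots> = cmod (f p * G (z p)) * exp (- (\<tau> * \<epsilon>) * (cdist N (z x) (z p))\<^sup>2)"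
      by (simp add: Gp mult.assoc exp_add [symmetric])
    finally show "cmod (f x * G (z x)) \<le> cmod (f p * G (z p)) * exp (- (\<tau> * \<epsilon>) * (cdist N (z x) (z p))\<^sup>2)" .
  qed
qed

section \<open>Maxima over compact sets and comparison with the boundary\<close>

lemma max_or_zero_eqI:
  assumes "y \<in> S" "\<And>x. x \<in> S \<Longrightarrow> x \<le> y"
  shows "max_or_zero S = y"
  using assms by (auto simp: max_or_zero_def intro!: Greatest_equality)

lemma max_or_zero_compact:
  assumes "compactin Y K" "continuous_map (subtopology Y K) euclidean (h :: 'a \<Rightarrow> real)" "K \<noteq> {}"
  obtains x where "x \<in> K" "\<And>y. y \<in> K \<Longrightarrow> h y \<le> h x" "max_or_zero (h ` K) = h x"
proof -
  have "compactin (subtopology Y K) K" using assms(1) by (simp add: compactin_subtopology)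
  then have "compact (h ` K)" using image_compactin [OF _ assms(2)] by simp
  then obtain x where x: "x \<in> K" "\<And>y. y \<in> K \<Longrightarrow> h y \<le> h x"
    using compact_attains_sup [of "h ` K"] assms(3) by auto
  moreover have "max_or_zero (h ` K) = h x"
    by (rule max_or_zero_eqI) (use x in auto)
  ultimately show thesis by (rule that)
qed

theorem theorem3p6:
  fixes X :: "'a topology"
    and \<O> :: "'a set \<Rightarrow> ('a \<Rightarrow> complex) set"
    and A D :: "'a set"
    and \<rho> :: "'a \<Rightarrow> real"
    and f :: "'a \<Rightarrow> complex"
  assumes "reduced_complex_space X \<O>"
    and "pure_dimensional X \<O>"
    and "strictly_psh_on_space X \<O> \<rho>"
    and "locally_closed_in X A"
    and "weakly_pseudoconcave X \<O> 1 A"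
    and "openin (subtopology X A) D"
    and "compactin (subtopology X A) (subtopology X A closure_of D)"
    and "f \<in> LACR X \<O> A D"
    and "continuous_fun X (subtopology X A closure_of D) f"
  shows "max_or_zero ((\<lambda>z. cmod (f z)) ` (subtopology X A closure_of D)) =
         max_or_zero ((\<lambda>z. cmod (f z)) ` (subtopology X A frontier_of D))"
proof -
  define K where "K = subtopology X A closure_of D"
  define B where "B = subtopology X A frontier_of D"
  define h where "h = (\<lambda>x. cmod (f x))"
  have KA: "compactin X K" "K \<subseteq> A"
    using assms(7) by (auto simp: K_def compactin_subtopology)
  have BK: "B \<subseteq> K" unfolding B_def K_def by (simp add: frontier_of_def)
  have cB: "compactin X B"
  proof -
    have "compactin (subtopology X A) (K \<inter> B)"
      unfolding B_def K_def by (rule compact_Int_closedin [OF assms(7) closedin_frontier_of])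
    then show ?thesis using BK by (simp add: compactin_subtopology Int_absorb1)
  qed
  \<comment> \<open>As \<open>D\<close> is open in \<open>A\<close>, its closure without its
    frontier is its interior, which is \<open>D\<close> itself.\<close>
  have KD: "x \<in> D" if "x \<in> K" "x \<notin> B" for x
    using that interior_of_openin [OF assms(6)] by (auto simp: K_def B_def frontier_of_def)
  have ch: "continuous_map (subtopology X K) euclidean h"
    using assms(9) unfolding h_def K_def continuous_fun_def by (rule continuous_map_norm)
  have chB: "continuous_map (subtopology X B) euclidean h"
    by (rule continuous_map_from_subtopology_mono [OF ch BK])
  have c\<rho>: "continuous_map (subtopology X K) euclidean \<rho>"
    by (rule continuous_map_from_subtopology [OF strictly_psh_on_space_continuous [OF assms(3)]])
  have cK: "compactin (subtopology X K) K" using KA(1) by (simp add: compactin_subtopology)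
  \<comment> \<open>A bound \<open>m\<close> in place of the maximum over \<open>B\<close> allows
    \<open>m = 0\<close> when \<open>B\<close> is empty.\<close>
  have no_gap: False
    if y: "y \<in> K" and m: "0 \<le> m" "m < h y" "\<And>x. x \<in> B \<Longrightarrow> h x \<le> m" for y m
  proof -
    have "compact (\<rho> ` K)" using image_compactin [OF cK c\<rho>] by simp
    then obtain R where R: "\<And>x. x \<in> K \<Longrightarrow> \<bar>\<rho> x\<bar> \<le> R"
      using compact_imp_bounded [of "\<rho> ` K"] unfolding bounded_iff by auto
    have R0: "0 \<le> R" using R [OF y] by linarith
    \<comment> \<open>On \<open>K\<close> the values of \<open>\<rho>\<close> differ by at most
      \<open>2 * R\<close>, so the weight favours a point of \<open>B\<close> over \<open>y\<close>
      by a factor of at most \<open>exp (\<tau> * (2 * R))\<close>; a small \<open>\<tau>\<close>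
      keeps \<open>y\<close> ahead of \<open>B\<close>.\<close>
    have "((\<lambda>t. m * exp (t * (2 * R))) \<longlongrightarrow> m * exp (0 * (2 * R))) (at_right 0)"
      by (intro tendsto_intros)
    then have "\<forall>\<^sub>F t in at_right 0. m * exp (t * (2 * R)) < h y"
      using m(2) by (intro order_tendstoD(2)) auto
    then obtain \<tau> where \<tau>: "0 < \<tau>" "m * exp (\<tau> * (2 * R)) < h y"
      using eventually_happens' [OF trivial_limit_at_right_real
          eventually_conj [OF _ eventually_at_right_less [of 0]]] by blast
    define u where "u = (\<lambda>x. h x * exp (\<tau> * \<rho> x))"
    have "continuous_map (subtopology X K) euclidean (\<lambda>x. exp (\<tau> * \<rho> x))"
      using continuous_map_compose [OF c\<rho>, of euclidean "\<lambda>s. exp (\<tau> * s)"]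
      by (simp add: o_def continuous_intros)
    then have "continuous_map (subtopology X K) euclidean u"
      unfolding u_def by (rule continuous_map_real_mult [OF ch])
    then obtain p where p: "p \<in> K" "\<And>x. x \<in> K \<Longrightarrow> u x \<le> u p"
      using max_or_zero_compact [OF KA(1)] y by (metis empty_iff)
    have "p \<notin> B"
    proof
      assume "p \<in> B"
      then have "u p \<le> m * exp (\<tau> * R)"
        unfolding u_def using m(1,3) R [OF p(1)] \<tau>(1) by (intro mult_mono) auto
      also have "\<dots> = (m * exp (\<tau> * (2 * R))) * exp (\<tau> * - R)"
        by (simp add: mult.assoc exp_add [symmetric])
      also have "\<dots> < h y * exp (\<tau> * - R)"
        using \<tau>(2) by (intro mult_strict_right_mono) auto
      also have "\<dots> \<le> u y"
      proof -
        have "\<tau> * - R \<le> \<tau> * \<rho> y"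
          using R [OF y] \<tau>(1) by (intro mult_left_mono) auto
        then show ?thesis
          unfolding u_def by (intro mult_left_mono) (simp_all add: h_def del: mult_minus_right)
      qed
      finally show False using p(2) [OF y] by simp
    qed
    then have pD: "p \<in> D" using KD p(1) by blast
    have "0 < u y" using m(1,2) by (simp add: u_def)
    then have "0 < u p" using p(2) [OF y] by linarith
    then have "f p \<noteq> 0" by (auto simp: u_def h_def)
    moreover have "D \<subseteq> K"
      unfolding K_def by (rule closure_of_subset) (rule openin_subset [OF assms(6)])
    then have "\<And>x. x \<in> D \<Longrightarrow> cmod (f x) * exp (\<tau> * \<rho> x) \<le> cmod (f p) * exp (\<tau> * \<rho> p)"
      using p(2) unfolding u_def h_def by blast
    moreover have "p \<in> topspace X" using p(1) compactin_subset_topspace [OF KA(1)] by blast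
    ultimately have "peak_at X \<O> A f p"
      using weighted_local_max_imp_peak_at [OF assms(3,6) pD _ \<tau>(1)] by blast
    then show False using LACR_not_peak_at [OF assms(1,4,5,6,8) pD] by blast
  qed
  have "max_or_zero (h ` K) = max_or_zero (h ` B)"
  proof (cases "K = {}")
    case True
    then show ?thesis using BK by simp
  next
    case False
    obtain y where y: "y \<in> K" "\<And>x. x \<in> K \<Longrightarrow> h x \<le> h y" "max_or_zero (h ` K) = h y"
      using max_or_zero_compact [OF KA(1) ch False] by blast
    show ?thesis
    proof (cases "B = {}")
      case True
      \<comment> \<open>With an empty boundary \<open>m = 0\<close> is admissible; so
        \<open>f\<close> vanishes on \<open>K\<close>, in accordance with the value \<open>0\<close>
        of the maximum over the empty set.\<close>
      have "\<not> 0 < h y" using no_gap [OF y(1), of 0] True by auto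
      then have "h y = 0" by (simp add: h_def)
      then show ?thesis using y(3) True by (simp add: max_or_zero_def)
    next
      case B: False
      obtain b where b: "b \<in> B" "\<And>x. x \<in> B \<Longrightarrow> h x \<le> h b" "max_or_zero (h ` B) = h b"
        using max_or_zero_compact [OF cB chB B] by blast
      have "\<not> h b < h y" using no_gap [OF y(1), of "h b"] b(2) by (auto simp: h_def)
      moreover have "h b \<le> h y" using y(2) b(1) BK by blast
      ultimately show ?thesis using y(3) b(3) by simp
    qed
  qed
  then show ?thesis unfolding h_def K_def B_def .
qed

end
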